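(* Let $\mathcal X,\mathcal Y$ be real Hilbert spaces, $f:\mathcal X\to(-\infty,+\infty]$ and $g:\mathcal Y\to(-\infty,+\infty]$ proper, convex and lower semicontinuous, and $A:\mathcal X\to\mathcal Y$ bounded linear. Let $\beta,\gamma:[0,+\infty)\to\mathbb R$ be differentiable with $\beta(t)>\gamma(t)$ for every $t\ge0$. Let $\alpha_0,\delta_0>0$, $Z=\frac{\beta-\gamma}{2}$, $Z_0=Z(0)$, $$W(t)=\frac{\|A\|}{2}\,\frac{|\beta(t)+\gamma(t)|}{\beta(t)-\gamma(t)},\qquad \Xi(t)=\frac{Z_0}{Z(t)}\exp\left(\int_0^t\frac{ds}{Z(s)}\right),$$ $$\alpha(t)=\frac1{\Xi(t)}\left[\alpha_0-\sqrt{\frac{\alpha_0}{\delta_0}}\int_0^t\Xi(s)W(s)\,ds\right],\qquad \delta(t)=\frac1{\Xi(t)}\left[\delta_0-\sqrt{\frac{\delta_0}{\alpha_0}}\int_0^t\Xi(s)W(s)\,ds\right],$$ and assume that, for all $t\ge0$, $$4Z(t)\Xi(t)W(t)+\int_0^t\Xi(s)W(s)\,ds\le\sqrt{\alpha_0\delta_0}$$ (equivalently, $\|A\||\beta+\gamma|\le\sqrt{\alpha\delta}$; this ensures $\alpha,\delta>0$). Let $(x,y):[0,+\infty)\to\mathcal X\times\mathcal Y$ be a trajectory, with $(x(0),y(0))=(x_0,y_0)$, of $$\left\{\begin{array}{rcl}\alpha(t)\dot x(t)+\beta(t)A^*\dot y(t)+\partial f(x(t))+A^*y(t)&\ni&0\\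 \gamma(t)A\dot x(t)+\delta(t)\dot y(t)-Ax(t)+\partial g^*(y(t))&\ni&0.\end{array}\right.$$ Then, for every $(u,v)\in\mathcal X\times\mathcal Y$ and $(\bar x,\bar y)\in\mathcal S$, and every $t\ge 0$, $$\Delta_{u,v}(t)\le D_{u,v}(0)\exp\left(-\int_0^t\frac{ds}{Z(s)}\right),$$ $$f(x(t))-f(\bar x)+\langle A^*\bar y,x(t)-\bar x\rangle\le D_{\bar x,\bar y}(0)\exp\left(-\int_0^t\frac{ds}{Z(s)}\right),$$ $$g^*(y(t))-g^*(\bar y)+\langle y(t)-\bar y,-A\bar x\rangle\le D_{\bar x,\bar y}(0)\exp\left(-\int_0^t\frac{ds}{Z(s)}\right),$$ where $$D_{u,v}(0)=\frac{\alpha_0}{2Z_0}\|x_0-u\|^2+\frac{\delta_0}{2Z_0}\|y_0-v\|^2+\Delta_{u,v}(0).$$ In particular, if $\int_0^\infty\frac{ds}{Z(s)}=\infty$, then every weak subsequential limit point of $(x(t),y(t))$, as $t\to+\infty$, belongs to $\mathcal S$. If, moreover, $\int_0^\infty\Xi(s)W(s)\,ds<\sqrt{\alpha_0\delta_0}$ (and $\mathcal S\neq\emptyset$), the trajectory remains bounded. Finally, if $\int_0^\infty\frac{ds}{Z(s)}=\infty$ and we further assume that $f$ is $\mu$-strongly convex ($\mu>0$), then $x(t)$ converges strongly, as $t\to+\infty$, to the unique $\bar x$, with $$\|x(t)-\bar x\|^2\le\frac{2D_{\bar x,\bar y}(0)}{\mu}\exp\left(-\int_0^t\frac{ds}{Z(s)}\right).$$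 Similarly, if $g$ is $L$-smooth ($L>0$), then $$\|y(t)-\bar y\|^2\le2L\,D_{\bar x,\bar y}(0)\exp\left(-\int_0^t\frac{ds}{Z(s)}\right).$$
   Context: $A^*$ is the adjoint of $A$, $\partial$ the convex subdifferential, $g^*$ the Fenchel conjugate of $g$. The underlying problem is $\min_{x\in\mathcal X}f(x)+g(Ax)$. A primal-dual solution is a pair $(\bar x,\bar y)\in\mathcal X\times\mathcal Y$ with $-A^*\bar y\in\partial f(\bar x)$ and $A\bar x\in\partial g^*(\bar y)$; $\mathcal S$ is the set of primal-dual solutions. A trajectory of the system is a pair of functions $x:[0,+\infty)\to\mathcal X$, $y:[0,+\infty)\to\mathcal Y$ that are locally absolutely continuous, such that $f\circ x$ and $g^*\circ y$ are (finite and) locally absolutely continuous on $[0,+\infty)$, and the system holds for almost every $t>0$. The Lagrangian is $\mathcal L(u,v)=f(u)+\langle v,Au\rangle-g^*(v)$. The duality gap along $(x,y)$ is $$\Delta_{u,v}(t)=\mathcal L(x(t),v)-\mathcal L(u,y(t))=[f(x(t))-f(u)+\langle A^*v,x(t)-u\rangle]+[g^*(y(t))-g^*(v)+\langle y(t)-v,-Au\rangle],$$ with value $-\infty$ if $f(u)=+\infty$ or $g^*(v)=+\infty$. A weak subsequential limit point of $(x(t),y(t))$ as $t\to+\infty$ is a weak limit of $(x(t_k),y(t_k))$ for some sequence $t_k\to+\infty$. "$g$ is $L$-smooth" means $g$ is differentiable with $L$-Lipschitz gradient. *)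

theory Defs
  imports "HOL-Analysis.Analysis"
begin

definition proper_fun :: "('a \<Rightarrow> ereal) \<Rightarrow> bool" where
  "proper_fun f \<longleftrightarrow> (\<forall>x. f x \<noteq> -\<infinity>) \<and> (\<exists>x. f x \<noteq> \<infinity>)"

(* convex_fun and strongly_convex_fun are only used for functions that never take
   the value -\<infinity>, so no sum \<infinity> + (-\<infinity>) occurs in the inequalities. *)

definition convex_fun :: "('a::real_vector \<Rightarrow> ereal) \<Rightarrow> bool" where
  "convex_fun f \<longleftrightarrow> (\<forall>x y. \<forall>r\<in>{0<..<1}.
     f ((1 - r) *\<^sub>R x + r *\<^sub>R y) \<le> ereal (1 - r) * f x + ereal r * f y)"

definition strongly_convex_fun :: "real \<Rightarrow> ('a::real_inner \<Rightarrow> ereal) \<Rightarrow> bool" where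
  "strongly_convex_fun \<mu> f \<longleftrightarrow> (\<forall>x y. \<forall>r\<in>{0<..<1}.
     f ((1 - r) *\<^sub>R x + r *\<^sub>R y) + ereal (\<mu> / 2 * r * (1 - r) * (norm (x - y))\<^sup>2)
       \<le> ereal (1 - r) * f x + ereal r * f y)"

definition lsc_fun :: "('a::topological_space \<Rightarrow> ereal) \<Rightarrow> bool" where
  "lsc_fun f \<longleftrightarrow> (\<forall>x. f x \<le> Liminf (nhds x) f)"

definition smooth_fun :: "real \<Rightarrow> ('a::real_inner \<Rightarrow> ereal) \<Rightarrow> bool" where
  "smooth_fun L f \<longleftrightarrow> (\<forall>x. \<bar>f x\<bar> \<noteq> \<infinity>) \<and>
     (\<exists>G. (\<forall>x. GDERIV (\<lambda>z. real_of_ereal (f z)) x :> G x) \<and> L-lipschitz_on UNIV G)"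

definition subdifferential :: "('a::real_inner \<Rightarrow> ereal) \<Rightarrow> 'a \<Rightarrow> 'a set" where
  "subdifferential f x = {p. \<forall>z. f x + ereal (p \<bullet> (z - x)) \<le> f z}"

definition fenchel_conjugate :: "('a::real_inner \<Rightarrow> ereal) \<Rightarrow> 'a \<Rightarrow> ereal" where
  "fenchel_conjugate g y = (SUP z. ereal (y \<bullet> z) - g z)"

definition weakly_converges :: "(nat \<Rightarrow> 'a::real_inner) \<Rightarrow> 'a \<Rightarrow> bool" where
  "weakly_converges X l \<longleftrightarrow> (\<forall>z. (\<lambda>k. X k \<bullet> z) \<longlonglongrightarrow> l \<bullet> z)"

definition weak_subseq_limit_point :: "(real \<Rightarrow> 'a::real_inner) \<Rightarrow> 'a \<Rightarrow> bool" where
  "weak_subseq_limit_point z l \<longleftrightarrow>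
     (\<exists>\<tau>::nat \<Rightarrow> real. filterlim \<tau> at_top sequentially \<and> weakly_converges (\<lambda>k. z (\<tau> k)) l)"

definition abs_continuous_on :: "real set \<Rightarrow> (real \<Rightarrow> 'a::metric_space) \<Rightarrow> bool" where
  "abs_continuous_on S h \<longleftrightarrow> (\<forall>\<epsilon>>0. \<exists>\<delta>>0. \<forall>(n::nat) a b.
     (\<forall>i<n. a i \<le> b i \<and> {a i..b i} \<subseteq> S) \<and>
     disjoint_family_on (\<lambda>i. {a i<..<b i}) {..<n} \<and>
     (\<Sum>i<n. b i - a i) < \<delta>
     \<longrightarrow> (\<Sum>i<n. dist (h (a i)) (h (b i))) < \<epsilon>)"

definition locally_abs_continuous :: "(real \<Rightarrow> 'a::metric_space) \<Rightarrow> bool" where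
  "locally_abs_continuous h \<longleftrightarrow> (\<forall>T>0. abs_continuous_on {0..T} h)"

definition primal_dual_solutions ::
  "('a::real_inner \<Rightarrow> ereal) \<Rightarrow> ('b::real_inner \<Rightarrow> ereal) \<Rightarrow> ('a \<Rightarrow> 'b) \<Rightarrow> ('a \<times> 'b) set" where
  "primal_dual_solutions f g A = {(x, y).
     - adjoint A y \<in> subdifferential f x \<and> A x \<in> subdifferential (fenchel_conjugate g) y}"

definition lagrangian ::
  "('a::real_inner \<Rightarrow> ereal) \<Rightarrow> ('b::real_inner \<Rightarrow> ereal) \<Rightarrow> ('a \<Rightarrow> 'b) \<Rightarrow> 'a \<Rightarrow> 'b \<Rightarrow> ereal" where
  "lagrangian f g A u v = f u + ereal (v \<bullet> A u) - fenchel_conjugate g v"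

(* Along a trajectory f (x t) and fenchel_conjugate g (y t) are finite, so the difference
   below is never \<infinity> - \<infinity>, and it is -\<infinity> if f u = \<infinity> or fenchel_conjugate g v = \<infinity>. *)
definition duality_gap ::
  "('a::real_inner \<Rightarrow> ereal) \<Rightarrow> ('b::real_inner \<Rightarrow> ereal) \<Rightarrow> ('a \<Rightarrow> 'b) \<Rightarrow>
   (real \<Rightarrow> 'a) \<Rightarrow> (real \<Rightarrow> 'b) \<Rightarrow> 'a \<Rightarrow> 'b \<Rightarrow> real \<Rightarrow> ereal" where
  "duality_gap f g A x y u v t = lagrangian f g A (x t) v - lagrangian f g A u (y t)"

(* Functions on [0,\<infinity>) are total functions on the reals of which only the values at
   t \<ge> 0 matter. The differential inclusions include the existence of the two
   derivatives at almost every t > 0. *)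
definition pd_trajectory ::
  "('a::real_inner \<Rightarrow> ereal) \<Rightarrow> ('b::real_inner \<Rightarrow> ereal) \<Rightarrow> ('a \<Rightarrow> 'b) \<Rightarrow>
   (real \<Rightarrow> real) \<Rightarrow> (real \<Rightarrow> real) \<Rightarrow> (real \<Rightarrow> real) \<Rightarrow> (real \<Rightarrow> real) \<Rightarrow>
   (real \<Rightarrow> 'a) \<Rightarrow> (real \<Rightarrow> 'b) \<Rightarrow> bool" where
  "pd_trajectory f g A \<alpha> \<beta> \<gamma> \<delta> x y \<longleftrightarrow>
     locally_abs_continuous x \<and> locally_abs_continuous y \<and>
     (\<forall>t\<ge>0. \<bar>f (x t)\<bar> \<noteq> \<infinity> \<and> \<bar>fenchel_conjugate g (y t)\<bar> \<noteq> \<infinity>) \<and>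
     locally_abs_continuous (\<lambda>t. real_of_ereal (f (x t))) \<and>
     locally_abs_continuous (\<lambda>t. real_of_ereal (fenchel_conjugate g (y t))) \<and>
     (AE t in lborel. t > 0 \<longrightarrow> (\<exists>x' y'.
        (x has_vector_derivative x') (at t) \<and> (y has_vector_derivative y') (at t) \<and>
        0 \<in> (\<lambda>\<xi>. \<alpha> t *\<^sub>R x' + \<beta> t *\<^sub>R adjoint A y' + \<xi> + adjoint A (y t))
              ` subdifferential f (x t) \<and>
        0 \<in> (\<lambda>\<eta>. \<gamma> t *\<^sub>R A x' + \<delta> t *\<^sub>R y' - A (x t) + \<eta>)
              ` subdifferential (fenchel_conjugate g) (y t)))"

end

theory Submission
  imports Defs
begin

text \<open>The flow has a Lyapunov function. Fix \<open>(u, v)\<close> at which \<open>f\<close> and \<open>g\<^sup>*\<close> are finite and put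
\<open>c = sqrt (\<alpha>0 * \<delta>0)\<close>, \<open>\<rho> = sqrt (\<alpha>0 / \<delta>0)\<close>, \<open>J t = \<integral>\<^sub>0\<^sup>t 1/Z\<close>, \<open>I t = \<integral>\<^sub>0\<^sup>t \<Xi> W\<close>. Then \<open>\<alpha> \<Xi> = \<rho> (c - I)\<close> and
\<open>\<delta> \<Xi> = (c - I) / \<rho>\<close>, and the energy
\<open>E t = Z0 exp (J t) \<Delta>\<^sub>u\<^sub>v t + \<rho>/2 (c - I t) |x t - u|\<^sup>2 + 1/(2\<rho>) (c - I t) |y t - v|\<^sup>2\<close>
is nonincreasing. As \<open>Z0 exp J = \<Xi> Z\<close>, its derivative is \<open>\<Xi>\<close> times
\<open>\<Delta> + Z \<Delta>'\<close> plus the derivatives of the quadratic terms. When the two inclusions are inserted, the undifferentiated terms of \<open>\<Delta>\<close> cancel; what remains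
is the damping \<open>- Z (\<alpha> |x'|\<^sup>2 + \<delta> |y'|\<^sup>2)\<close>, the decay \<open>- W/2\<close> of the weights, and cross terms \<open>(\<beta> + \<gamma>)/2 * \<langle>A _, _\<rangle>\<close>. The choice of \<open>Z\<close> makes both kinds of cross
terms carry the same coefficient, \<open>W\<close> is chosen such that \<open>2 Z W = |A| |\<beta> + \<gamma>|/2\<close>, and then Young's
inequality absorbs all of them exactly under the parameter condition \<open>4 Z \<Xi> W \<le> c - I\<close>
(\<open>young_cross_terms\<close>, \<open>energy_dissipation\<close>).

The trajectory is only absolutely continuous, and the inclusions at a time \<open>t\<close> say nothing about
differentiability of \<open>f \<circ> x\<close> and \<open>g\<^sup>* \<circ> y\<close> there. So the derivative is computed on a substitute: replacing
\<open>f (x s)\<close> and \<open>g\<^sup>* (y s)\<close> by the affine minorants given by the subgradients at time \<open>t\<close> yields a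
function that touches the energy from below at \<open>t\<close> and is differentiable there with nonpositive
derivative. For an absolutely continuous function such tangent minorants at almost every \<open>t\<close> force
monotonicity (\<open>abs_continuous_on_tangent_minorants_imp_le\<close>).

Monotonicity of the energy gives the bound on the gap (\<open>gap_bound\<close>). At a solution the gap is a sum
of two nonnegative parts, so each part obeys the bound, and strong convexity of \<open>f\<close> or smoothness of
\<open>g\<close> (which makes \<open>g\<^sup>*\<close> grow quadratically away from a subgradient point) turns the parts into
distances. If \<open>c - I\<close> stays away from zero, the quadratic terms bound the trajectory. If
\<open>J \<rightarrow> \<infinity>\<close>, all gaps have nonpositive upper limit, and weak lower semicontinuity passes this to
weak limit points, which are therefore saddle points of the Lagrangian. The weak lower
semicontinuity of \<open>f\<close> and the defining property of the adjoint both come from projection onto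
closed convex sets in a Hilbert space.\<close>

section \<open>Absolutely continuous functions\<close>

text \<open>The common source of the closure properties below: sums, products and bounded linear images of absolutely
continuous functions all have increments controlled by those of the constituents.\<close>

lemma abs_continuous_on_dominated:
  fixes h :: "real \<Rightarrow> 'a::metric_space" and h1 :: "real \<Rightarrow> 'b::metric_space"
    and h2 :: "real \<Rightarrow> 'c::metric_space"
  assumes h1: "abs_continuous_on S h1" and h2: "abs_continuous_on S h2"
    and dom: "\<And>s t. s \<in> S \<Longrightarrow> t \<in> S \<Longrightarrow>
      dist (h s) (h t) \<le> C * (dist (h1 s) (h1 t) + dist (h2 s) (h2 t))"
  shows "abs_continuous_on S h"
  unfolding abs_continuous_on_def
proof (intro allI impI)
  fix \<epsilon> :: real assume "\<epsilon> > 0"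
  define K where "K = max C 1"
  have K: "K > 0" "C \<le> K" by (auto simp: K_def)
  with \<open>\<epsilon> > 0\<close> have "\<epsilon> / (2 * K) > 0" by simp
  from h1[unfolded abs_continuous_on_def, rule_format, OF this]
  obtain d1 where d1: "d1 > 0" "\<And>(n::nat) a b.
     (\<forall>i<n. a i \<le> b i \<and> {a i..b i} \<subseteq> S) \<Longrightarrow>
     disjoint_family_on (\<lambda>i. {a i<..<b i}) {..<n} \<Longrightarrow>
     (\<Sum>i<n. b i - a i) < d1 \<Longrightarrow> (\<Sum>i<n. dist (h1 (a i)) (h1 (b i))) < \<epsilon> / (2 * K)"
    by meson
  from h2[unfolded abs_continuous_on_def, rule_format, OF \<open>\<epsilon> / (2 * K) > 0\<close>]
  obtain d2 where d2: "d2 > 0" "\<And>(n::nat) a b.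
     (\<forall>i<n. a i \<le> b i \<and> {a i..b i} \<subseteq> S) \<Longrightarrow>
     disjoint_family_on (\<lambda>i. {a i<..<b i}) {..<n} \<Longrightarrow>
     (\<Sum>i<n. b i - a i) < d2 \<Longrightarrow> (\<Sum>i<n. dist (h2 (a i)) (h2 (b i))) < \<epsilon> / (2 * K)"
    by meson
  show "\<exists>\<delta>>0. \<forall>(n::nat) a b.
     (\<forall>i<n. a i \<le> b i \<and> {a i..b i} \<subseteq> S) \<and>
     disjoint_family_on (\<lambda>i. {a i<..<b i}) {..<n} \<and>
     (\<Sum>i<n. b i - a i) < \<delta> \<longrightarrow> (\<Sum>i<n. dist (h (a i)) (h (b i))) < \<epsilon>"
  proof (intro exI[of _ "min d1 d2"] conjI allI impI)
    show "0 < min d1 d2" using d1 d2 by simp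
    fix n :: nat and a b :: "nat \<Rightarrow> real"
    assume ab: "(\<forall>i<n. a i \<le> b i \<and> {a i..b i} \<subseteq> S) \<and>
      disjoint_family_on (\<lambda>i. {a i<..<b i}) {..<n} \<and> (\<Sum>i<n. b i - a i) < min d1 d2"
    have "(\<Sum>i<n. dist (h (a i)) (h (b i)))
        \<le> (\<Sum>i<n. K * (dist (h1 (a i)) (h1 (b i)) + dist (h2 (a i)) (h2 (b i))))"
    proof (rule sum_mono)
      fix i assume "i \<in> {..<n}"
      then have "a i \<in> S" "b i \<in> S" using ab by (auto simp: subset_iff)
      from dom[OF this]
      show "dist (h (a i)) (h (b i)) \<le> K * (dist (h1 (a i)) (h1 (b i)) + dist (h2 (a i)) (h2 (b i)))"
        by (rule order_trans) (intro mult_right_mono K add_nonneg_nonneg zero_le_dist)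
    qed
    also have "\<dots> = K * ((\<Sum>i<n. dist (h1 (a i)) (h1 (b i))) + (\<Sum>i<n. dist (h2 (a i)) (h2 (b i))))"
      by (simp only: sum_distrib_left[symmetric] sum.distrib)
    also have "\<dots> < K * (\<epsilon> / (2 * K) + \<epsilon> / (2 * K))"
      using ab d1(2)[of n a b] d2(2)[of n a b] K
      by (intro mult_strict_left_mono add_strict_mono) auto
    also have "\<dots> = \<epsilon>" using K by simp
    finally show "(\<Sum>i<n. dist (h (a i)) (h (b i))) < \<epsilon>" .
  qed
qed

lemma abs_continuous_on_imp_continuous_on:
  fixes h :: "real \<Rightarrow> 'a::metric_space"
  assumes h: "abs_continuous_on {l..u} h"
  shows "continuous_on {l..u} h"
  unfolding continuous_on_iff
proof (intro ballI allI impI)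
  fix s and e :: real assume s: "s \<in> {l..u}" and e: "0 < e"
  from h[unfolded abs_continuous_on_def, rule_format, OF e]
  obtain d where d: "d > 0" "\<And>(n::nat) a b.
     (\<forall>i<n. a i \<le> b i \<and> {a i..b i} \<subseteq> {l..u}) \<Longrightarrow>
     disjoint_family_on (\<lambda>i. {a i<..<b i}) {..<n} \<Longrightarrow>
     (\<Sum>i<n. b i - a i) < d \<Longrightarrow> (\<Sum>i<n. dist (h (a i)) (h (b i))) < e"
    by meson
  have "dist (h t) (h s) < e" if t: "t \<in> {l..u}" "dist t s < d" for t
  proof -
    have "dist (h (min s t)) (h (max s t)) < e"
      using d(2)[of 1 "\<lambda>_. min s t" "\<lambda>_. max s t"] s t
      by (simp add: disjoint_family_on_def dist_real_def)
    then show ?thesis by (auto simp: min_def max_def dist_commute split: if_splits)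
  qed
  with d(1) show "\<exists>d>0. \<forall>t\<in>{l..u}. dist t s < d \<longrightarrow> dist (h t) (h s) < e" by blast
qed

lemma abs_continuous_on_imp_bounded:
  fixes h :: "real \<Rightarrow> 'a::real_normed_vector"
  assumes "abs_continuous_on {l..u} h"
  obtains M where "M \<ge> 0" "\<And>t. t \<in> {l..u} \<Longrightarrow> norm (h t) \<le> M"
proof -
  have "bounded (h ` {l..u})"
    using assms by (intro compact_imp_bounded compact_continuous_image
        abs_continuous_on_imp_continuous_on) auto
  then obtain M where "\<forall>t\<in>{l..u}. norm (h t) \<le> M" unfolding bounded_iff by blast
  then show ?thesis by (intro that[of "max M 0"]) (auto simp: le_max_iff_disj)
qed

lemma abs_continuous_on_lipschitz:
  fixes h :: "real \<Rightarrow> 'a::metric_space"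
  assumes "L-lipschitz_on S h"
  shows "abs_continuous_on S h"
  unfolding abs_continuous_on_def
proof (intro allI impI)
  fix \<epsilon> :: real assume e: "\<epsilon> > 0"
  have L: "L \<ge> 0" using assms by (rule lipschitz_on_nonneg)
  show "\<exists>\<delta>>0. \<forall>(n::nat) a b.
     (\<forall>i<n. a i \<le> b i \<and> {a i..b i} \<subseteq> S) \<and>
     disjoint_family_on (\<lambda>i. {a i<..<b i}) {..<n} \<and>
     (\<Sum>i<n. b i - a i) < \<delta> \<longrightarrow> (\<Sum>i<n. dist (h (a i)) (h (b i))) < \<epsilon>"
  proof (intro exI[of _ "\<epsilon> / (L + 1)"] conjI allI impI)
    show "0 < \<epsilon> / (L + 1)" using e L by simp
    fix n :: nat and a b :: "nat \<Rightarrow> real"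
    assume ab: "(\<forall>i<n. a i \<le> b i \<and> {a i..b i} \<subseteq> S) \<and>
      disjoint_family_on (\<lambda>i. {a i<..<b i}) {..<n} \<and> (\<Sum>i<n. b i - a i) < \<epsilon> / (L + 1)"
    have "(\<Sum>i<n. dist (h (a i)) (h (b i))) \<le> (\<Sum>i<n. L * (b i - a i))"
    proof (rule sum_mono)
      fix i assume "i \<in> {..<n}"
      then have i: "a i \<in> S" "b i \<in> S" "a i \<le> b i" using ab by (auto simp: subset_iff)
      then show "dist (h (a i)) (h (b i)) \<le> L * (b i - a i)"
        using lipschitz_onD[OF assms i(1,2)] by (simp add: dist_real_def)
    qed
    also have "\<dots> = L * (\<Sum>i<n. b i - a i)" by (simp add: sum_distrib_left)
    also have "\<dots> \<le> L * (\<epsilon> / (L + 1))" using ab L by (intro mult_left_mono) auto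
    also have "\<dots> < \<epsilon>" using e L by (simp add: field_simps)
    finally show "(\<Sum>i<n. dist (h (a i)) (h (b i))) < \<epsilon>" .
  qed
qed

lemma abs_continuous_on_const: "abs_continuous_on S (\<lambda>_. c)"
  by (rule abs_continuous_on_lipschitz[of 0]) (simp add: lipschitz_on_def)

lemma abs_continuous_on_add:
  fixes h k :: "real \<Rightarrow> 'a::real_normed_vector"
  assumes "abs_continuous_on S h" "abs_continuous_on S k"
  shows "abs_continuous_on S (\<lambda>t. h t + k t)"
  by (rule abs_continuous_on_dominated[OF assms, where C = 1])
    (simp add: dist_triangle_add)

lemma abs_continuous_on_bounded_linear:
  fixes h :: "real \<Rightarrow> 'a::real_normed_vector"
  assumes F: "bounded_linear F" and h: "abs_continuous_on S h"
  shows "abs_continuous_on S (\<lambda>t. F (h t))"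
proof -
  obtain K where K: "K \<ge> 0" "\<And>x. norm (F x) \<le> norm x * K"
    using bounded_linear.nonneg_bounded[OF F] by blast
  show ?thesis
  proof (rule abs_continuous_on_dominated[OF h abs_continuous_on_const[of S "0::real"], where C = K])
    fix s t
    show "dist (F (h s)) (F (h t)) \<le> K * (dist (h s) (h t) + dist (0::real) 0)"
      using K(2)[of "h s - h t"] by (simp add: dist_norm linear_diff[OF bounded_linear.linear[OF F]] mult.commute)
  qed
qed

lemma abs_continuous_on_diff:
  fixes h k :: "real \<Rightarrow> 'a::real_normed_vector"
  assumes "abs_continuous_on S h" "abs_continuous_on S k"
  shows "abs_continuous_on S (\<lambda>t. h t - k t)"
  using abs_continuous_on_add[OF assms(1)
      abs_continuous_on_bounded_linear[OF bounded_linear_minus[OF bounded_linear_ident] assms(2)]]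
  by simp

lemma abs_continuous_on_bounded_bilinear:
  fixes h :: "real \<Rightarrow> 'a::real_normed_vector" and k :: "real \<Rightarrow> 'b::real_normed_vector"
  assumes B: "bounded_bilinear B"
    and h: "abs_continuous_on {l..u} h" and k: "abs_continuous_on {l..u} k"
  shows "abs_continuous_on {l..u} (\<lambda>t. B (h t) (k t))"
proof -
  obtain K where K: "K \<ge> 0" "\<And>x y. norm (B x y) \<le> norm x * norm y * K"
    using bounded_bilinear.nonneg_bounded[OF B] by blast
  obtain M where M: "M \<ge> 0" "\<And>t. t \<in> {l..u} \<Longrightarrow> norm (h t) \<le> M"
    using abs_continuous_on_imp_bounded[OF h] by blast
  obtain N where N: "N \<ge> 0" "\<And>t. t \<in> {l..u} \<Longrightarrow> norm (k t) \<le> N"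
    using abs_continuous_on_imp_bounded[OF k] by blast
  show ?thesis
  proof (rule abs_continuous_on_dominated[OF h k, where C = "(M + N) * K"])
    fix s t assume st: "s \<in> {l..u}" "t \<in> {l..u}"
    have "B (h s) (k s) - B (h t) (k t) = B (h s - h t) (k s) + B (h t) (k s - k t)"
      by (simp add: bounded_bilinear.diff_left[OF B] bounded_bilinear.diff_right[OF B])
    then have "dist (B (h s) (k s)) (B (h t) (k t)) \<le> norm (B (h s - h t) (k s)) + norm (B (h t) (k s - k t))"
      by (simp add: dist_norm norm_triangle_ineq)
    also have "\<dots> \<le> norm (h s - h t) * norm (k s) * K + norm (h t) * norm (k s - k t) * K"
      by (intro add_mono K)
    also have "\<dots> \<le> norm (h s - h t) * (M + N) * K + (M + N) * norm (k s - k t) * K"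
      using M N K st by (intro add_mono mult_right_mono mult_left_mono) (auto intro: add_increasing add_increasing2)
    also have "\<dots> = (M + N) * K * (dist (h s) (h t) + dist (k s) (k t))"
      by (simp add: dist_norm algebra_simps)
    finally show "dist (B (h s) (k s)) (B (h t) (k t)) \<le> (M + N) * K * (dist (h s) (h t) + dist (k s) (k t))" .
  qed
qed

lemma abs_continuous_on_derivative:
  fixes h :: "real \<Rightarrow> real"
  assumes h: "\<And>t. t \<in> {l..u} \<Longrightarrow> (h has_real_derivative h' t) (at t within {l..u})"
    and h': "continuous_on {l..u} h'"
  shows "abs_continuous_on {l..u} h"
proof -
  have "bounded (h' ` {l..u})" by (intro compact_imp_bounded compact_continuous_image h') simp
  then obtain M where M: "\<And>t. t \<in> {l..u} \<Longrightarrow> \<bar>h' t\<bar> \<le> M"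
    unfolding bounded_iff by (auto simp del: atLeastAtMost_iff)
  have "(max M 0)-lipschitz_on {l..u} h"
  proof (rule bounded_derivative_imp_lipschitz)
    fix t assume t: "t \<in> {l..u}"
    show "(h has_derivative (*) (h' t)) (at t within {l..u})"
      using h[OF t] by (simp add: has_field_derivative_def)
    show "onorm ((*) (h' t)) \<le> max M 0"
      using M[OF t] by (intro onorm_bound) (auto simp: abs_mult intro!: mult_right_mono)
  qed auto
  then show ?thesis by (rule abs_continuous_on_lipschitz)
qed

section \<open>Monotonicity from tangent minorants\<close>

lemma sum_lengths_le_emeasure:
  fixes a b :: "nat \<Rightarrow> real"
  assumes ab: "\<And>i. i < n \<Longrightarrow> a i \<le> b i \<and> {a i..b i} \<subseteq> U"
    and disj: "disjoint_family_on (\<lambda>i. {a i<..<b i}) {..<n}" and U: "U \<in> sets lborel"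
  shows "ennreal (\<Sum>i<n. b i - a i) \<le> emeasure lborel U"
proof -
  have "ennreal (\<Sum>i<n. b i - a i) = (\<Sum>i<n. ennreal (b i - a i))"
    using ab by (intro sum_ennreal[symmetric]) auto
  also have "\<dots> = (\<Sum>i<n. emeasure lborel {a i<..<b i})"
    using ab by (intro sum.cong) auto
  also have "\<dots> = emeasure lborel (\<Union>i<n. {a i<..<b i})"
    using disj by (intro sum_emeasure) auto
  also have "\<dots> \<le> emeasure lborel U"
    using ab U by (intro emeasure_mono) (auto simp: subset_iff)
  finally show ?thesis .
qed

text \<open>Let \<open>U\<close> be an open neighbourhood of the null set \<open>N\<close>, so small that absolute continuity bounds the
variation of \<open>F\<close> over intervals inside \<open>U\<close> by \<open>\<epsilon>\<close>. With \<open>V s\<close> the variation of \<open>F\<close> over intervals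
inside \<open>U \<inter> {s..T}\<close>, the inequality \<open>F T - F s \<le> \<epsilon> (T - s) + V s\<close> is carried from \<open>s = T\<close> down to
\<open>s = 0\<close>: at a point outside \<open>N\<close> a small step to the left is possible by the minorant, at a point of
\<open>N\<close> a small step stays in \<open>U\<close> and is paid for by \<open>V\<close>, and the set of good \<open>s\<close> contains its infimum
because \<open>F\<close> is continuous and \<open>V\<close> is antitone. The descent goes to the left because a
minorant bounds the growth of \<open>F\<close> from above on that side of its contact point only.\<close>

lemma abs_continuous_on_tangent_minorants_imp_le:
  fixes F :: "real \<Rightarrow> real"
  assumes T: "0 < T" and F: "abs_continuous_on {0..T} F"
    and N: "N \<in> null_sets lborel"
    and minorant: "\<And>t. 0 < t \<Longrightarrow> t \<le> T \<Longrightarrow> t \<notin> N \<Longrightarrow>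
      \<exists>R m. R t = F t \<and> (\<forall>s\<in>{0..T}. R s \<le> F s) \<and> (R has_real_derivative m) (at t) \<and> m \<le> 0"
  shows "F T \<le> F 0"
proof -
  have contF: "continuous_on {0..T} F" using F by (rule abs_continuous_on_imp_continuous_on)
  have main: "F T - F 0 \<le> \<epsilon> * T + \<epsilon>" if e: "\<epsilon> > 0" for \<epsilon>
  proof -
    from F[unfolded abs_continuous_on_def, rule_format, OF e]
    obtain d where d: "d > 0" "\<And>(n::nat) a b.
       (\<forall>i<n. a i \<le> b i \<and> {a i..b i} \<subseteq> {0..T}) \<Longrightarrow>
       disjoint_family_on (\<lambda>i. {a i<..<b i}) {..<n} \<Longrightarrow>
       (\<Sum>i<n. b i - a i) < d \<Longrightarrow> (\<Sum>i<n. dist (F (a i)) (F (b i))) < \<epsilon>"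
      by meson
    obtain U where U: "open U" "N \<subseteq> U" "emeasure lborel (U - N) < ennreal d"
      using outer_regular_lborel[of N d] N d(1) by (auto simp: null_sets_def)
    have Ud: "emeasure lborel U < ennreal d"
      using U emeasure_Diff_null_set[OF N, of U] by simp
    define Fam where "Fam s = {(n, a, b). (\<forall>i<n. a i \<le> b i \<and> {a i..b i} \<subseteq> U \<inter> {s..T}) \<and>
      disjoint_family_on (\<lambda>i. {a i<..<b i}) {..<n::nat}}" for s
    define v where "v = (\<lambda>(n::nat, a, b). \<Sum>i<n. dist (F (a i)) (F (b i)))"
    define V where "V s = Sup (v ` Fam s)" for s
    have v_less: "v c < \<epsilon>" if "s \<ge> 0" "c \<in> Fam s" for s c
    proof -
      obtain n a b where c: "c = (n, a, b)" by (cases c)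
      have ab: "\<forall>i<n. a i \<le> b i \<and> {a i..b i} \<subseteq> U \<inter> {s..T}"
        "disjoint_family_on (\<lambda>i. {a i<..<b i}) {..<n}"
        using that(2) by (auto simp: Fam_def c)
      have "ennreal (\<Sum>i<n. b i - a i) \<le> emeasure lborel U"
        using ab U(1) by (intro sum_lengths_le_emeasure) auto
      also note Ud
      finally have "(\<Sum>i<n. b i - a i) < d"
        using d(1) ab(1) by (subst (asm) ennreal_less_iff) (auto intro!: sum_nonneg)
      moreover have "\<forall>i<n. a i \<le> b i \<and> {a i..b i} \<subseteq> {0..T}"
        using ab(1) that(1) by (fastforce simp: subset_iff)
      ultimately show ?thesis using d(2)[of n a b] ab(2) by (simp add: v_def c)
    qed
    have bdd: "bdd_above (v ` Fam s)" if "s \<ge> 0" for s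
      using v_less[OF that] by (auto intro!: bdd_aboveI[of _ \<epsilon>] less_imp_le)
    have empty: "(0, (\<lambda>_. 0), (\<lambda>_. 0)) \<in> Fam s" for s
      by (simp add: Fam_def disjoint_family_on_def)
    have V_mono: "V t \<le> V s" if "0 \<le> s" "s \<le> t" for s t
      unfolding V_def
    proof (rule cSup_subset_mono)
      show "v ` Fam t \<noteq> {}" using empty by blast
      show "bdd_above (v ` Fam s)" using that bdd by simp
      show "v ` Fam t \<subseteq> v ` Fam s"
        using that by (intro image_mono) (fastforce simp: Fam_def subset_iff)
    qed
    have V_le: "V s \<le> \<epsilon>" if "s \<ge> 0" for s
      unfolding V_def using v_less[OF that] empty[of s] by (intro cSup_least) (auto intro: less_imp_le)
    have V_ge0: "V s \<ge> 0" if "s \<ge> 0" for s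
      unfolding V_def using cSup_upper[OF imageI[OF empty] bdd[OF that]] by (simp add: v_def)
    have V_step: "V t + \<bar>F t - F s\<bar> \<le> V s" if s: "0 \<le> s" "s \<le> t" "t \<le> T" "{s..t} \<subseteq> U" for s t
    proof -
      have "v c \<le> V s - \<bar>F t - F s\<bar>" if c0: "c \<in> Fam t" for c
      proof -
        obtain n a b where c: "c = (n, a, b)" by (cases c)
        have ab: "\<And>i. i < n \<Longrightarrow> a i \<le> b i \<and> {a i..b i} \<subseteq> U \<inter> {t..T}"
          "disjoint_family_on (\<lambda>i. {a i<..<b i}) {..<n}"
          using c0 by (auto simp: Fam_def c)
        have ta: "t \<le> a i" "b i \<le> T" if "i < n" for i
          using ab(1)[OF that] by (auto simp: subset_iff)
        \<comment> \<open>The interval from \<open>s\<close> to \<open>t\<close> lies left of all intervals of the family, so it may be appended.\<close>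
        let ?c = "(Suc n, a(n := s), b(n := t))"
        have "?c \<in> Fam s"
          unfolding Fam_def mem_Collect_eq prod.case
        proof (intro conjI allI impI)
          fix i assume i: "i < Suc n"
          show "(a(n := s)) i \<le> (b(n := t)) i" using i s ab(1)[of i] by (auto simp: less_Suc_eq)
          show "{(a(n := s)) i..(b(n := t)) i} \<subseteq> U \<inter> {s..T}"
            using i s ab(1)[of i] ta[of i] by (auto simp: less_Suc_eq)
        next
          show "disjoint_family_on (\<lambda>i. {(a(n := s)) i<..<(b(n := t)) i}) {..<Suc n}"
            unfolding disjoint_family_on_def
          proof (intro ballI impI)
            fix i j assume ij: "i \<in> {..<Suc n}" "j \<in> {..<Suc n}" "i \<noteq> j"
            then consider "i < n" "j < n" | "i = n" "j < n" | "i < n" "j = n" by fastforce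
            then show "{(a(n := s)) i<..<(b(n := t)) i} \<inter> {(a(n := s)) j<..<(b(n := t)) j} = {}"
            proof cases
              case 1
              then show ?thesis using ab(2) ij by (auto simp: disjoint_family_on_def)
            next
              case 2
              then show ?thesis using ta[of j] by auto
            next
              case 3
              then show ?thesis using ta[of i] by auto
            qed
          qed
        qed
        then have "v ?c \<le> V s" unfolding V_def using bdd s by (intro cSup_upper) auto
        moreover have "v ?c = v c + \<bar>F t - F s\<bar>"
          by (simp add: v_def c dist_real_def abs_minus_commute)
        ultimately show ?thesis by simp
      qed
      then have "V t \<le> V s - \<bar>F t - F s\<bar>"
        unfolding V_def[of t] using empty[of t] by (intro cSup_least) auto
      then show ?thesis by simp
    qed
    \<comment> \<open>Continuous induction downwards from \<open>T\<close>.\<close>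
    define G where "G = {s \<in> {0..T}. F T - F s \<le> \<epsilon> * (T - s) + V s}"
    define m where "m = Inf G"
    have TG: "T \<in> G" using T V_ge0[of T] by (simp add: G_def)
    have bddG: "bdd_below G" by (auto simp: G_def)
    have m: "0 \<le> m" "m \<le> T"
      using TG bddG unfolding m_def by (auto intro!: cInf_greatest cInf_lower) (auto simp: G_def)
    have "m \<in> G"
    proof (rule ccontr)
      assume "m \<notin> G"
      then have "F T - F m - (\<epsilon> * (T - m) + V m) > 0" (is "?\<eta> > 0")
        using m by (auto simp: G_def)
      then obtain r where r: "r > 0" "\<And>s. s \<in> {0..T} \<Longrightarrow> dist s m < r \<Longrightarrow> dist (F s) (F m) < ?\<eta>"
        using contF m unfolding continuous_on_iff by (metis atLeastAtMost_iff)
      obtain s where s: "s \<in> G" "s < m + r"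
        using cInf_lessD[of G "m + r"] TG r(1) unfolding m_def by auto
      have ms: "m \<le> s" using s bddG unfolding m_def by (auto intro: cInf_lower)
      have "dist (F s) (F m) < ?\<eta>" using r(2)[of s] s ms by (auto simp: G_def dist_real_def)
      moreover have "F T - F s \<le> \<epsilon> * (T - s) + V s" using s by (simp add: G_def)
      moreover have "\<epsilon> * (T - s) \<le> \<epsilon> * (T - m)" using e ms by simp
      ultimately show False using V_mono[of m s] m ms by (simp add: dist_real_def)
    qed
    have "m = 0"
    proof (rule ccontr)
      assume "m \<noteq> 0"
      then have m0: "m > 0" using m by simp
      have "\<exists>s\<in>{0..<m}. F m - F s \<le> \<epsilon> * (m - s) + (V s - V m)"
      \<comment> \<open>Either case extends \<open>G\<close> to the left of its infimum.\<close>
      proof (cases "m \<in> N")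
        case True
        then obtain r where r: "r > 0" "ball m r \<subseteq> U" using U openE by blast
        define s where "s = max 0 (m - r / 2)"
        have s: "0 \<le> s" "s < m" "m - s < r" using m0 r(1) by (auto simp: s_def max_def)
        have "{s..m} \<subseteq> U" using r s by (auto simp: subset_iff dist_real_def)
        then have "V m + \<bar>F m - F s\<bar> \<le> V s" using s m by (intro V_step) auto
        moreover have "\<epsilon> * (m - s) \<ge> 0" using e s by simp
        ultimately show ?thesis using s by (intro bexI[of _ s]) auto
      next
        case False
        obtain R m' where R: "R m = F m" "\<And>s. s \<in> {0..T} \<Longrightarrow> R s \<le> F s"
          "(R has_real_derivative m') (at m)" "m' \<le> 0"
          using minorant[OF m0 m(2) False] by blast
        from R(3) have "((\<lambda>h. (R (m + h) - R m) / h) \<longlongrightarrow> m') (at 0)" by (simp add: DERIV_def)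
        moreover have "m' < \<epsilon>" using R(4) e by simp
        ultimately have "\<forall>\<^sub>F h in at 0. (R (m + h) - R m) / h < \<epsilon>" by (rule order_tendstoD)
        then obtain r where r: "r > 0"
          "\<And>h. h \<noteq> 0 \<Longrightarrow> dist h 0 < r \<Longrightarrow> (R (m + h) - R m) / h < \<epsilon>"
          unfolding eventually_at by auto
        define h where "h = min (r / 2) m"
        have h: "h > 0" "h < r" "h \<le> m" using r(1) m0 by (auto simp: h_def)
        have "(R (m + - h) - R m) / (- h) < \<epsilon>" using r(2)[of "- h"] h by simp
        then have "R m - R (m - h) < \<epsilon> * h" using h by (simp add: field_simps)
        then have "F m - F (m - h) \<le> \<epsilon> * h" using R(1) R(2)[of "m - h"] h m by simp
        moreover have "V m \<le> V (m - h)" using h by (intro V_mono) auto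
        ultimately show ?thesis using h by (intro bexI[of _ "m - h"]) auto
      qed
      then obtain s where s: "0 \<le> s" "s < m" "F m - F s \<le> \<epsilon> * (m - s) + (V s - V m)" by auto
      moreover have "F T - F m \<le> \<epsilon> * (T - m) + V m" using \<open>m \<in> G\<close> by (simp add: G_def)
      ultimately have "s \<in> G" using m by (simp add: G_def algebra_simps)
      then have "m \<le> s" using bddG unfolding m_def by (auto intro: cInf_lower)
      with s show False by simp
    qed
    with \<open>m \<in> G\<close> have "F T - F 0 \<le> \<epsilon> * T + V 0" by (simp add: G_def)
    with V_le[of 0] show ?thesis by simp
  qed
  show ?thesis
  proof (rule field_le_epsilon)
    fix e :: real assume "0 < e"
    then have "F T - F 0 \<le> e / (T + 1) * T + e / (T + 1)" using T by (intro main) simp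
    also have "\<dots> = e" using T by (simp add: divide_simps) (simp add: algebra_simps)
    finally show "F T \<le> F 0 + e" by simp
  qed
qed

section \<open>Hilbert space: projection, adjoint and weak lower semicontinuity\<close>

text \<open>A minimizing sequence for the distance to \<open>a\<close> is Cauchy by the parallelogram law, since midpoints
stay in \<open>C\<close>. The obtuse angle property is the first-order condition at the minimizer.\<close>

lemma exists_projection_closed_convex:
  fixes a :: "'a::{real_inner, complete_space}"
  assumes C: "closed C" "convex C" "C \<noteq> {}"
  obtains p where "p \<in> C" "\<And>z. z \<in> C \<Longrightarrow> (a - p) \<bullet> (z - p) \<le> 0"
proof -
  define D where "D = (INF z\<in>C. (norm (z - a))\<^sup>2)"
  have D_le: "D \<le> (norm (z - a))\<^sup>2" if "z \<in> C" for z
    unfolding D_def using that by (intro cINF_lower bdd_belowI2[of _ 0]) auto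
  have "\<exists>z\<in>C. (norm (z - a))\<^sup>2 < D + 1 / real (Suc n)" for n
    using cInf_lessD[of "(\<lambda>z. (norm (z - a))\<^sup>2) ` C" "D + 1 / real (Suc n)"] C(3)
    by (auto simp: D_def)
  then obtain X where X: "\<And>n. X n \<in> C" "\<And>n. (norm (X n - a))\<^sup>2 < D + 1 / real (Suc n)"
    by metis
  have X_dist: "(norm (X m - X n))\<^sup>2 \<le> 2 / real (Suc m) + 2 / real (Suc n)" for m n
  proof -
    let ?c = "(1 / 2) *\<^sub>R X m + (1 / 2) *\<^sub>R X n"
    have "?c \<in> C" using X(1) C(2) by (intro convexD) auto
    then have "D \<le> (norm (?c - a))\<^sup>2" by (rule D_le)
    moreover have "(norm (X m - X n))\<^sup>2 + 4 * (norm (?c - a))\<^sup>2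
        = 2 * (norm (X m - a))\<^sup>2 + 2 * (norm (X n - a))\<^sup>2"
      by (simp add: power2_norm_eq_inner inner_add_left inner_add_right inner_diff_left
          inner_diff_right inner_commute algebra_simps)
    ultimately show ?thesis using X(2)[of m] X(2)[of n] by simp
  qed
  have "Cauchy X"
  proof (rule metric_CauchyI)
    fix e :: real assume e: "e > 0"
    obtain N :: nat where N: "4 / e\<^sup>2 < real N" using reals_Archimedean2 by blast
    have "dist (X m) (X n) < e" if mn: "m \<ge> N" "n \<ge> N" for m n
    proof -
      have N0: "real N > 0" using N e by (meson divide_pos_pos less_trans zero_less_numeral zero_less_power)
      have "2 / real (Suc k) < e\<^sup>2 / 2" if "k \<ge> N" for k
      proof -
        have "4 / e\<^sup>2 < real (Suc k)" using N that by simp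
        then show ?thesis using e by (simp add: field_simps)
      qed
      from this[OF mn(1)] this[OF mn(2)] X_dist[of m n]
      have "(norm (X m - X n))\<^sup>2 < e\<^sup>2" by simp
      then show ?thesis using e by (simp add: dist_norm power_less_imp_less_base)
    qed
    then show "\<exists>M. \<forall>m\<ge>M. \<forall>n\<ge>M. dist (X m) (X n) < e" by blast
  qed
  then obtain p where p: "X \<longlonglongrightarrow> p" using Cauchy_convergent convergent_def by blast
  have "p \<in> C" using closed_sequentially[OF C(1) X(1) p] .
  have "(\<lambda>n. D + 1 / real (Suc n)) \<longlonglongrightarrow> D + 0"
    using LIMSEQ_inverse_real_of_nat by (intro tendsto_add tendsto_const) (simp add: inverse_eq_divide)
  moreover have "(\<lambda>n. (norm (X n - a))\<^sup>2) \<longlonglongrightarrow> (norm (p - a))\<^sup>2"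
    by (intro tendsto_intros p)
  ultimately have p_le: "(norm (p - a))\<^sup>2 \<le> D"
    using X(2) by (intro tendsto_le[OF sequentially_bot]) (auto intro: less_imp_le always_eventually)
  have "(a - p) \<bullet> (z - p) \<le> 0" if z: "z \<in> C" for z
  proof (rule field_le_epsilon)
    fix e :: real assume e: "e > 0"
    define r where "r = min 1 (e / ((norm (z - p))\<^sup>2 + 1))"
    have r: "0 < r" "r \<le> 1" "r * (norm (z - p))\<^sup>2 \<le> e"
    proof -
      show "0 < r" "r \<le> 1" using e by (auto simp: r_def intro!: divide_pos_pos add_nonneg_pos)
      have "r * (norm (z - p))\<^sup>2 \<le> e / ((norm (z - p))\<^sup>2 + 1) * ((norm (z - p))\<^sup>2 + 1)"
        using \<open>0 < r\<close> by (intro mult_mono) (auto simp: r_def)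
      also have "\<dots> = e" by (simp add: add_nonneg_eq_0_iff)
      finally show "r * (norm (z - p))\<^sup>2 \<le> e" .
    qed
    have "(1 - r) *\<^sub>R p + r *\<^sub>R z \<in> C" using \<open>p \<in> C\<close> z r C(2) by (intro convexD) auto
    then have "(norm (p - a))\<^sup>2 \<le> (norm ((1 - r) *\<^sub>R p + r *\<^sub>R z - a))\<^sup>2"
      using D_le order_trans[OF p_le] by blast
    also have "(1 - r) *\<^sub>R p + r *\<^sub>R z - a = (p - a) + r *\<^sub>R (z - p)" by (simp add: algebra_simps)
    also have "(norm \<dots>)\<^sup>2 = (norm (p - a))\<^sup>2 + 2 * r * ((p - a) \<bullet> (z - p)) + r * r * (norm (z - p))\<^sup>2"
      by (simp only: power2_norm_eq_inner inner_add_left inner_add_right inner_scaleR_left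
          inner_scaleR_right) (simp add: inner_commute algebra_simps)
    finally have "r * (2 * ((a - p) \<bullet> (z - p))) \<le> r * (r * (norm (z - p))\<^sup>2)"
      by (simp add: inner_diff_left algebra_simps)
    then have "2 * ((a - p) \<bullet> (z - p)) \<le> e" using r by simp
    then show "(a - p) \<bullet> (z - p) \<le> 0 + e" using e by simp
  qed
  with \<open>p \<in> C\<close> show ?thesis by (rule that)
qed

text \<open>The element of least norm in the hyperplane \<open>\<phi> x = 1\<close> is orthogonal to the kernel of \<open>\<phi>\<close>, hence
represents \<open>\<phi>\<close> up to a factor.\<close>

lemma riesz_representation:
  fixes \<phi> :: "'a::{real_inner, complete_space} \<Rightarrow> real"
  assumes \<phi>: "bounded_linear \<phi>"
  shows "\<exists>w. \<forall>x. \<phi> x = x \<bullet> w"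
proof (cases "\<forall>x. \<phi> x = 0")
  case True
  then show ?thesis by (intro exI[of _ 0]) simp
next
  case False
  interpret bounded_linear \<phi> by (rule \<phi>)
  obtain e where "\<phi> e \<noteq> 0" using False by blast
  then have "\<phi> ((1 / \<phi> e) *\<^sub>R e) = 1" by (simp add: scaleR)
  then have ne: "{x. \<phi> x = 1} \<noteq> {}" by blast
  have "closed {x. \<phi> x = 1}" by (intro closed_Collect_eq continuous_intros continuous_on)
  moreover have "convex {x. \<phi> x = 1}" by (auto simp: convex_def add scaleR)
  ultimately obtain p where p: "p \<in> {x. \<phi> x = 1}"
    "\<And>z. z \<in> {x. \<phi> x = 1} \<Longrightarrow> (0 - p) \<bullet> (z - p) \<le> 0"
    using exists_projection_closed_convex ne by metis
  have orth: "h \<bullet> p = 0" if "\<phi> h = 0" for h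
    using p(2)[of "p + h"] p(2)[of "p - h"] p(1) that by (simp add: add diff inner_commute)
  have "p \<noteq> 0" using p(1) zero by auto
  have "\<phi> x = x \<bullet> (p /\<^sub>R (p \<bullet> p))" for x
    using orth[of "x - \<phi> x *\<^sub>R p"] p(1) \<open>p \<noteq> 0\<close>
    by (simp add: diff scaleR inner_diff_left field_simps)
  then show ?thesis by blast
qed

text \<open>\<^const>\<open>adjoint\<close> is defined by choice; in a complete space the Riesz representation supplies a
witness, so the choice has the expected property.\<close>

lemma inner_adjoint_bounded_linear:
  fixes A :: "'a::{real_inner, complete_space} \<Rightarrow> 'b::real_inner"
  assumes A: "bounded_linear A"
  shows "x \<bullet> adjoint A y = A x \<bullet> y"
proof -
  have "\<exists>w. \<forall>x. A x \<bullet> y = x \<bullet> w" for y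
    by (intro riesz_representation bounded_linear_compose[OF bounded_linear_inner_left A])
  then have "\<exists>A'. \<forall>x y. A x \<bullet> y = x \<bullet> A' y" by metis
  then have "\<forall>x y. A x \<bullet> y = x \<bullet> adjoint A y" unfolding adjoint_def by (rule someI_ex)
  then show ?thesis by simp
qed

text \<open>The sublevel set at level \<open>c\<close> is closed and convex and does not contain \<open>l\<close>. The direction from the
projection of \<open>l\<close> to \<open>l\<close> separates the two strictly, and weak convergence carries \<open>X k\<close> to the side
of \<open>l\<close>.\<close>

lemma convex_lsc_weakly_lsc:
  fixes f :: "'a::{real_inner, complete_space} \<Rightarrow> ereal"
  assumes f: "convex_fun f" "lsc_fun f" and X: "weakly_converges X l" and c: "ereal c < f l"
  shows "\<forall>\<^sub>F k in sequentially. ereal c < f (X k)"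
proof (cases "{z. f z \<le> ereal c} = {}")
  case True
  then have "\<not> f z \<le> ereal c" for z by blast
  then show ?thesis by (intro always_eventually allI) (simp only: not_le)
next
  case False
  let ?C = "{z. f z \<le> ereal c}"
  have "open {z. ereal c < f z}"
  proof (rule iffD2[OF open_subopen], intro ballI)
    fix z assume "z \<in> {z. ereal c < f z}"
    then have "ereal c < Liminf (nhds z) f"
      using f(2) by (auto simp: lsc_fun_def intro: less_le_trans)
    then have "\<forall>\<^sub>F w in nhds z. ereal c < f w" by (rule less_LiminfD)
    then obtain T where "open T" "z \<in> T" "\<forall>w\<in>T. ereal c < f w"
      unfolding eventually_nhds by blast
    then show "\<exists>T. open T \<and> z \<in> T \<and> T \<subseteq> {z. ereal c < f z}"
      by (intro exI[of _ T]) auto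
  qed
  moreover have "{z. ereal c < f z} = - ?C" by auto
  ultimately have "closed ?C" by (simp add: closed_def)
  moreover have "convex ?C"
    unfolding convex_alt
  proof (intro ballI allI impI)
    fix x y and r :: real assume xy: "x \<in> ?C" "y \<in> ?C" and r: "0 \<le> r \<and> r \<le> 1"
    show "(1 - r) *\<^sub>R x + r *\<^sub>R y \<in> ?C"
    proof (cases "r = 0 \<or> r = 1")
      case True
      then show ?thesis using xy by auto
    next
      case False
      then have r': "r \<in> {0<..<1}" using r by auto
      then have "f ((1 - r) *\<^sub>R x + r *\<^sub>R y) \<le> ereal (1 - r) * f x + ereal r * f y"
        using f(1) by (auto simp: convex_fun_def)
      also have "\<dots> \<le> ereal (1 - r) * ereal c + ereal r * ereal c"
        using xy r by (intro add_mono ereal_mult_left_mono) auto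
      also have "\<dots> = ereal c" by (simp add: algebra_simps)
      finally show ?thesis by simp
    qed
  qed
  ultimately obtain p where p: "p \<in> ?C" "\<And>z. z \<in> ?C \<Longrightarrow> (l - p) \<bullet> (z - p) \<le> 0"
    using exists_projection_closed_convex[of ?C l] False by blast
  have "l \<noteq> p" using c p(1) by auto
  have "(\<lambda>k. X k \<bullet> (l - p) - p \<bullet> (l - p)) \<longlonglongrightarrow> l \<bullet> (l - p) - p \<bullet> (l - p)"
    using X by (intro tendsto_diff tendsto_const) (simp add: weakly_converges_def)
  moreover have "l \<bullet> (l - p) - p \<bullet> (l - p) > 0"
    using \<open>l \<noteq> p\<close> by (simp flip: inner_diff_left)
  ultimately have "\<forall>\<^sub>F k in sequentially. 0 < X k \<bullet> (l - p) - p \<bullet> (l - p)"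
    by (rule order_tendstoD)
  then show ?thesis
  proof eventually_elim
    case (elim k)
    then show ?case using p(2)[of "X k"]
      by (force simp: inner_diff_left inner_diff_right inner_commute not_le[symmetric])
  qed
qed

lemma fenchel_young: "ereal (y \<bullet> z) - g z \<le> fenchel_conjugate g y"
  unfolding fenchel_conjugate_def by (rule SUP_upper) simp

text \<open>A conjugate is a supremum of weakly continuous affine functions.\<close>

lemma fenchel_conjugate_weakly_lsc:
  assumes X: "weakly_converges X l" and c: "ereal c < fenchel_conjugate g l"
  shows "\<forall>\<^sub>F k in sequentially. ereal c < fenchel_conjugate g (X k)"
proof -
  obtain z where z: "ereal c < ereal (l \<bullet> z) - g z"
    using c unfolding fenchel_conjugate_def less_SUP_iff by auto
  have lim: "(\<lambda>k. X k \<bullet> z) \<longlonglongrightarrow> l \<bullet> z" using X by (simp add: weakly_converges_def)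
  have "\<forall>\<^sub>F k in sequentially. ereal c < ereal (X k \<bullet> z) - g z"
  proof (cases "g z")
    case (real r)
    then have "\<forall>\<^sub>F k in sequentially. c + r < X k \<bullet> z"
      using z by (intro order_tendstoD(1)[OF lim]) simp
    then show ?thesis by eventually_elim (simp add: real)
  qed (use z in auto)
  then show ?thesis
    by eventually_elim (use fenchel_young less_le_trans in blast)
qed

section \<open>Quadratic growth\<close>

text \<open>Compare \<open>f\<close> with its subgradient at the point \<open>(1 - r) xb + r z\<close>, divide by \<open>r\<close>, and let
\<open>r \<rightarrow> 0\<close>.\<close>

lemma strongly_convex_growth:
  assumes sc: "strongly_convex_fun \<mu> f"
    and p: "p \<in> subdifferential f xb" and fin: "\<bar>f xb\<bar> \<noteq> \<infinity>" "\<bar>f z\<bar> \<noteq> \<infinity>"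
  shows "real_of_ereal (f xb) + p \<bullet> (z - xb) + \<mu> / 2 * (norm (z - xb))\<^sup>2 \<le> real_of_ereal (f z)"
proof -
  obtain a b where ab: "f xb = ereal a" "f z = ereal b" using fin by force
  have *: "a + p \<bullet> (z - xb) + \<mu> / 2 * (1 - r) * (norm (z - xb))\<^sup>2 \<le> b" if r: "r \<in> {0<..<1}" for r
  proof -
    let ?w = "(1 - r) *\<^sub>R xb + r *\<^sub>R z"
    have w: "?w - xb = r *\<^sub>R (z - xb)" by (simp add: algebra_simps)
    have "f xb + ereal (p \<bullet> (?w - xb)) \<le> f ?w" using p by (simp add: subdifferential_def)
    then have 1: "ereal (a + r * (p \<bullet> (z - xb))) \<le> f ?w" unfolding w by (simp add: ab)
    have "ereal (a + r * (p \<bullet> (z - xb))) + ereal (\<mu> / 2 * r * (1 - r) * (norm (xb - z))\<^sup>2)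
        \<le> f ?w + ereal (\<mu> / 2 * r * (1 - r) * (norm (xb - z))\<^sup>2)"
      using 1 by (rule add_right_mono)
    also have "\<dots> \<le> ereal (1 - r) * f xb + ereal r * f z"
      using sc r by (auto simp: strongly_convex_fun_def)
    finally have "r * (p \<bullet> (z - xb) + \<mu> / 2 * (1 - r) * (norm (z - xb))\<^sup>2) \<le> r * (b - a)"
      by (simp add: ab norm_minus_commute algebra_simps)
    then show ?thesis using r by simp
  qed
  have "((\<lambda>r. a + p \<bullet> (z - xb) + \<mu> / 2 * (1 - r) * (norm (z - xb))\<^sup>2)
      \<longlongrightarrow> a + p \<bullet> (z - xb) + \<mu> / 2 * (1 - 0) * (norm (z - xb))\<^sup>2) (at_right 0)"
    by (intro tendsto_intros)
  moreover have "\<forall>\<^sub>F r in at_right (0::real). r \<in> {0<..<1}"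
    by (rule eventually_at_right_real) simp
  then have "\<forall>\<^sub>F r in at_right 0. a + p \<bullet> (z - xb) + \<mu> / 2 * (1 - r) * (norm (z - xb))\<^sup>2 \<le> b"
    by eventually_elim (rule *)
  ultimately have "a + p \<bullet> (z - xb) + \<mu> / 2 * (1 - 0) * (norm (z - xb))\<^sup>2 \<le> b"
    by (intro tendsto_le[OF _ tendsto_const]) auto
  then show ?thesis by (simp add: ab)
qed

lemma GDERIV_along_line:
  assumes "GDERIV h (w + s *\<^sub>R k) :> G"
  shows "((\<lambda>s. h (w + s *\<^sub>R k)) has_real_derivative G \<bullet> k) (at s)"
proof -
  have "((\<lambda>s. w + s *\<^sub>R k) has_derivative (\<lambda>t. t *\<^sub>R k)) (at s)"
    by (auto intro!: derivative_eq_intros)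
  from has_derivative_compose[OF this, of h "\<lambda>z. z \<bullet> G"] assms
  have "((\<lambda>s. h (w + s *\<^sub>R k)) has_derivative (\<lambda>t. (t *\<^sub>R k) \<bullet> G)) (at s)"
    by (simp add: gderiv_def)
  then show ?thesis
    unfolding has_field_derivative_def
    by (rule has_derivative_eq_rhs) (simp add: fun_eq_iff inner_commute)
qed

lemma lipschitz_gradient_descent:
  fixes h :: "'a::real_inner \<Rightarrow> real"
  assumes G: "\<And>x. GDERIV h x :> G x" and L: "L-lipschitz_on UNIV G"
  shows "h (w + k) \<le> h w + G w \<bullet> k + L / 2 * (norm k)\<^sup>2"
proof -
  define \<phi> where "\<phi> s = h (w + s *\<^sub>R k) - s * (G w \<bullet> k) - L / 2 * s\<^sup>2 * (norm k)\<^sup>2" for s :: real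
  have d: "(\<phi> has_real_derivative G (w + s *\<^sub>R k) \<bullet> k - G w \<bullet> k - L * s * (norm k)\<^sup>2) (at s)" for s
  proof -
    have "((\<lambda>s. h (w + s *\<^sub>R k)) has_real_derivative G (w + s *\<^sub>R k) \<bullet> k) (at s)"
      by (rule GDERIV_along_line[OF G])
    then show ?thesis
      unfolding \<phi>_def by (auto intro!: derivative_eq_intros)
  qed
  have "\<phi> 1 \<le> \<phi> 0"
  proof (rule DERIV_nonpos_imp_nonincreasing[of 0 1 \<phi>])
    fix s :: real assume s: "0 \<le> s" "s \<le> 1"
    have "G (w + s *\<^sub>R k) \<bullet> k - G w \<bullet> k = (G (w + s *\<^sub>R k) - G w) \<bullet> k" by (simp add: inner_diff_left)
    also have "\<dots> \<le> norm (G (w + s *\<^sub>R k) - G w) * norm k" by (rule norm_cauchy_schwarz)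
    also have "\<dots> \<le> (L * (s * norm k)) * norm k"
      using lipschitz_onD[OF L, of "w + s *\<^sub>R k" w] s by (intro mult_right_mono) (auto simp: dist_norm)
    finally have "G (w + s *\<^sub>R k) \<bullet> k - G w \<bullet> k - L * s * (norm k)\<^sup>2 \<le> 0"
      by (simp add: power2_eq_square algebra_simps)
    with d show "\<exists>y. (\<phi> has_real_derivative y) (at s) \<and> y \<le> 0" by blast
  qed simp
  then show ?thesis by (simp add: \<phi>_def)
qed

lemma convex_gradient_inequality:
  fixes g :: "'a::real_inner \<Rightarrow> ereal"
  assumes g: "convex_fun g" and h: "\<And>z. g z = ereal (h z)" and G: "GDERIV h w :> G"
  shows "h w + G \<bullet> (z - w) \<le> h z"
proof -
  let ?k = "z - w"
  have "((\<lambda>s. h (w + s *\<^sub>R ?k)) has_real_derivative G \<bullet> ?k) (at 0)"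
    using G by (intro GDERIV_along_line) simp
  then have "((\<lambda>s. (h (w + s *\<^sub>R ?k) - h w) / s) \<longlongrightarrow> G \<bullet> ?k) (at_right 0)"
    unfolding DERIV_def by (auto intro: tendsto_mono[OF at_le])
  moreover have "\<forall>\<^sub>F s in at_right (0::real). s \<in> {0<..<1}"
    by (rule eventually_at_right_real) simp
  then have "\<forall>\<^sub>F s in at_right 0. (h (w + s *\<^sub>R ?k) - h w) / s \<le> h z - h w"
  proof eventually_elim
    case (elim s)
    have "w + s *\<^sub>R ?k = (1 - s) *\<^sub>R w + s *\<^sub>R z" by (simp add: algebra_simps)
    moreover have "g ((1 - s) *\<^sub>R w + s *\<^sub>R z) \<le> ereal (1 - s) * g w + ereal s * g z"
      using g elim by (auto simp: convex_fun_def)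
    ultimately have "h (w + s *\<^sub>R ?k) - h w \<le> (h z - h w) * s"
      by (simp add: h algebra_simps)
    then show ?case using elim by (simp add: pos_divide_le_eq)
  qed
  ultimately have "G \<bullet> ?k \<le> h z - h w"
    by (intro tendsto_le[OF _ tendsto_const]) auto
  then show ?thesis by simp
qed

text \<open>Testing the supremum that defines \<open>g\<^sup>* u\<close> at \<open>w + (u - \<nabla>g w) / L\<close>, the best point for the quadratic
upper model of \<open>g\<close> at \<open>w\<close>, gives \<open>g\<^sup>* u \<ge> \<langle>u, w\<rangle> - g w + |u - \<nabla>g w|\<^sup>2 / (2L)\<close> for all \<open>u\<close>.
For \<open>u = yb\<close>, combined with \<open>g\<^sup>* yb \<le> \<langle>yb, w\<rangle> - g w\<close>, it shows \<open>yb = \<nabla>g w\<close>; for \<open>u = v\<close> it is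
then the claim.\<close>

lemma smooth_conjugate_growth:
  fixes g :: "'a::real_inner \<Rightarrow> ereal"
  assumes g: "convex_fun g" "smooth_fun L g" and L: "L > 0"
    and w: "w \<in> subdifferential (fenchel_conjugate g) yb"
    and fin: "\<bar>fenchel_conjugate g yb\<bar> \<noteq> \<infinity>" "\<bar>fenchel_conjugate g v\<bar> \<noteq> \<infinity>"
  shows "real_of_ereal (fenchel_conjugate g yb) + w \<bullet> (v - yb) + 1 / (2 * L) * (norm (v - yb))\<^sup>2
    \<le> real_of_ereal (fenchel_conjugate g v)"
proof -
  define h where "h z = real_of_ereal (g z)" for z
  have h: "g z = ereal (h z)" for z
    using g(2) by (simp add: smooth_fun_def h_def ereal_real)
  obtain G where G: "\<And>z. GDERIV h z :> G z" "L-lipschitz_on UNIV G"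
    using g(2) unfolding smooth_fun_def h_def by auto
  have lower: "ereal (u \<bullet> w - h w + 1 / (2 * L) * (norm (u - G w))\<^sup>2) \<le> fenchel_conjugate g u" for u
  proof -
    define k where "k = (1 / L) *\<^sub>R (u - G w)"
    have "(u - G w) \<bullet> k = 1 / L * (norm (u - G w))\<^sup>2"
      by (simp add: k_def power2_norm_eq_inner)
    moreover have "L / 2 * (norm k)\<^sup>2 = 1 / (2 * L) * (norm (u - G w))\<^sup>2"
      using L by (simp add: k_def power_mult_distrib power2_eq_square)
    moreover have "1 / L * (norm (u - G w))\<^sup>2 = 2 * (1 / (2 * L) * (norm (u - G w))\<^sup>2)"
      by simp
    ultimately have "u \<bullet> w - h w + 1 / (2 * L) * (norm (u - G w))\<^sup>2
        = u \<bullet> (w + k) - (h w + G w \<bullet> k + L / 2 * (norm k)\<^sup>2)"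
      by (simp add: inner_diff_left inner_add_right)
    also have "\<dots> \<le> u \<bullet> (w + k) - h (w + k)"
      using lipschitz_gradient_descent[OF G, of w k] by simp
    also have "ereal \<dots> \<le> fenchel_conjugate g u"
      using fenchel_young[of u "w + k" g] by (simp add: h)
    finally show ?thesis by simp
  qed
  obtain a b where ab: "fenchel_conjugate g yb = ereal a" "fenchel_conjugate g v = ereal b"
    using fin by force
  \<comment> \<open>By convexity the gradient at \<open>w\<close> attains equality in the Fenchel-Young inequality.\<close>
  have "fenchel_conjugate g (G w) \<le> ereal (G w \<bullet> w - h w)"
    unfolding fenchel_conjugate_def
  proof (rule SUP_least)
    fix z
    show "ereal (G w \<bullet> z) - g z \<le> ereal (G w \<bullet> w - h w)"
      using convex_gradient_inequality[OF g(1) h G(1), of w z] by (simp add: h inner_diff_right)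
  qed
  moreover have "fenchel_conjugate g yb + ereal (w \<bullet> (G w - yb)) \<le> fenchel_conjugate g (G w)"
    using w by (simp add: subdifferential_def)
  ultimately have "ereal a + ereal (w \<bullet> (G w - yb)) \<le> ereal (G w \<bullet> w - h w)"
    unfolding ab by (rule order_trans[rotated])
  then have a_le: "a \<le> yb \<bullet> w - h w" by (simp add: inner_diff_right inner_commute)
  have "1 / (2 * L) * (norm (yb - G w))\<^sup>2 \<le> 0"
    using lower[of yb] a_le by (simp add: ab)
  then have "yb = G w" using L by (simp add: mult_le_0_iff divide_le_0_iff)
  then have "a + w \<bullet> (v - yb) + 1 / (2 * L) * (norm (v - yb))\<^sup>2 \<le> b"
    using lower[of v] a_le ab(2) by (simp add: inner_diff_right inner_commute)
  then show ?thesis by (simp add: ab)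
qed

section \<open>The dissipation inequality\<close>

text \<open>In the application \<open>a, b\<close> are the distances to \<open>u, v\<close> and \<open>X, Y\<close> the speeds. Young's inequality with
ratio \<open>2z\<close> splits the mixed products so that the distances are used up by the decay of the weights;
this costs \<open>2 z\<^sup>2 w\<close> in front of the squared speeds, and the product of the speeds costs the same
again. Together this is the factor \<open>4 z w\<close> that \<open>s\<close> has to dominate.\<close>

lemma young_cross_terms:
  fixes a b X Y r s w z :: real
  assumes r: "r > 0" and w: "w \<ge> 0" and z: "z \<ge> 0" and s: "4 * z * w \<le> s"
  shows "2 * z * w * (Y * a + X * b) + 4 * z\<^sup>2 * w * (X * Y)
    \<le> z * s * (r * X\<^sup>2 + Y\<^sup>2 / r) + w / 2 * (r * a\<^sup>2 + b\<^sup>2 / r)"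
proof -
  have 1: "2 * z * (Y * a) \<le> 1 / 2 * (r * a\<^sup>2) + 2 * z\<^sup>2 * (Y\<^sup>2 / r)"
    and 2: "2 * z * (X * b) \<le> 1 / 2 * (b\<^sup>2 / r) + 2 * z\<^sup>2 * (r * X\<^sup>2)"
    and 3: "2 * (X * Y) \<le> r * X\<^sup>2 + Y\<^sup>2 / r"
  proof -
    have "(r * a - 2 * z * Y)\<^sup>2 / r \<ge> 0" "(b - 2 * z * r * X)\<^sup>2 / r \<ge> 0" "(r * X - Y)\<^sup>2 / r \<ge> 0"
      using r by simp_all
    then show "2 * z * (Y * a) \<le> 1 / 2 * (r * a\<^sup>2) + 2 * z\<^sup>2 * (Y\<^sup>2 / r)"
      "2 * z * (X * b) \<le> 1 / 2 * (b\<^sup>2 / r) + 2 * z\<^sup>2 * (r * X\<^sup>2)"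
      "2 * (X * Y) \<le> r * X\<^sup>2 + Y\<^sup>2 / r"
      using r by (simp_all add: power2_eq_square field_simps)
  qed
  define q where "q = r * X\<^sup>2 + Y\<^sup>2 / r"
  have q0: "q \<ge> 0" using r by (simp add: q_def)
  have "w * (2 * z * (Y * a)) + w * (2 * z * (X * b)) + 2 * z\<^sup>2 * w * (2 * (X * Y))
      \<le> w * (1 / 2 * (r * a\<^sup>2) + 2 * z\<^sup>2 * (Y\<^sup>2 / r)) + w * (1 / 2 * (b\<^sup>2 / r) + 2 * z\<^sup>2 * (r * X\<^sup>2))
        + 2 * z\<^sup>2 * w * q"
    using 1 2 3 w by (intro add_mono mult_left_mono) (auto simp: q_def)
  also have "\<dots> = z * (4 * z * w) * q + w / 2 * (r * a\<^sup>2 + b\<^sup>2 / r)"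
    by (simp add: q_def power2_eq_square algebra_simps)
  also have "\<dots> \<le> z * s * q + w / 2 * (r * a\<^sup>2 + b\<^sup>2 / r)"
    using mult_right_mono[OF mult_left_mono[OF s z] q0] by simp
  finally show ?thesis by (simp add: q_def algebra_simps)
qed

text \<open>The derivative of the energy divided by \<open>\<Xi>\<close>, at a fixed time; \<open>p\<close> and \<open>q\<close> are the subgradients
selected by the flow, and \<open>s = (c - I) / \<Xi>\<close>. With \<open>\<beta> = \<sigma> + z\<close> and \<open>\<gamma> = \<sigma> - z\<close> the terms containing
\<open>z\<close> alone cancel against the derivative of the gap, and each remaining cross term has coefficient
\<open>\<sigma>\<close>, where \<open>|\<sigma>| |A| = 2 z w\<close>.\<close>

lemma energy_dissipation:
  fixes A :: "'a::{real_inner, complete_space} \<Rightarrow> 'b::real_inner"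
  assumes A: "bounded_linear A" and r: "r > 0" and w: "w \<ge> 0"
    and \<alpha>: "\<alpha> = r * s" and \<delta>: "\<delta> = s / r"
    and z: "z = (\<beta> - \<gamma>) / 2" "z > 0" and zw: "4 * z * w = onorm A * \<bar>\<beta> + \<gamma>\<bar>"
    and s: "4 * z * w \<le> s"
    and p: "p = - (\<alpha> *\<^sub>R x' + \<beta> *\<^sub>R adjoint A y' + adjoint A y)"
    and q: "q = - (\<gamma> *\<^sub>R A x' + \<delta> *\<^sub>R y' - A x)"
    and fu: "k + p \<bullet> (u - x) \<le> fu" and gv: "l + q \<bullet> (v - y) \<le> gv"
  shows "(k - fu + v \<bullet> A (x - u) + l - gv - (y - v) \<bullet> A u)
      + z * (p \<bullet> x' + v \<bullet> A x' + q \<bullet> y' - y' \<bullet> A u)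
      + r * (s * ((x - u) \<bullet> x') - w / 2 * (norm (x - u))\<^sup>2)
      + 1 / r * (s * ((y - v) \<bullet> y') - w / 2 * (norm (y - v))\<^sup>2) \<le> 0"
proof -
  interpret A: bounded_linear A by (rule A)
  define \<sigma> where "\<sigma> = (\<beta> + \<gamma>) / 2"
  have \<beta>\<gamma>: "\<beta> = \<sigma> + z" "\<gamma> = \<sigma> - z" by (simp_all add: \<sigma>_def z(1) field_simps)
  have adj: "adjoint A b \<bullet> h = A h \<bullet> b" for h b
    using inner_adjoint_bounded_linear[OF A, of h b] by (simp add: inner_commute)
  have ph: "p \<bullet> h = - (\<alpha> * (x' \<bullet> h) + \<beta> * (A h \<bullet> y') + A h \<bullet> y)" for h
    unfolding p by (simp add: inner_add_left inner_diff_left adj)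
  have qh: "q \<bullet> h = - (\<gamma> * (A x' \<bullet> h) + \<delta> * (y' \<bullet> h) - A x \<bullet> h)" for h
    unfolding q by (simp add: inner_add_left inner_diff_left)
  have "\<bar>\<sigma>\<bar> * onorm A = 2 * z * w" using zw by (simp add: \<sigma>_def abs_divide field_simps)
  then have cross: "\<bar>\<sigma> * (A h \<bullet> b)\<bar> \<le> 2 * z * w * (norm h * norm b)" for h b
  proof -
    have "\<bar>\<sigma> * (A h \<bullet> b)\<bar> \<le> \<bar>\<sigma>\<bar> * ((onorm A * norm h) * norm b)"
      unfolding abs_mult using onorm[OF A, of h]
      by (intro mult_left_mono order_trans[OF Cauchy_Schwarz_ineq2] mult_right_mono) auto
    then show ?thesis using \<open>\<bar>\<sigma>\<bar> * onorm A = 2 * z * w\<close> by (metis mult.assoc)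
  qed
  have "(k - fu + v \<bullet> A (x - u) + l - gv - (y - v) \<bullet> A u)
      + z * (p \<bullet> x' + v \<bullet> A x' + q \<bullet> y' - y' \<bullet> A u)
      + r * (s * ((x - u) \<bullet> x') - w / 2 * (norm (x - u))\<^sup>2)
      + 1 / r * (s * ((y - v) \<bullet> y') - w / 2 * (norm (y - v))\<^sup>2)
    \<le> (- (p \<bullet> (u - x)) + v \<bullet> A (x - u) - q \<bullet> (v - y) - (y - v) \<bullet> A u)
      + z * (p \<bullet> x' + v \<bullet> A x' + q \<bullet> y' - y' \<bullet> A u)
      + r * (s * ((x - u) \<bullet> x') - w / 2 * (norm (x - u))\<^sup>2)
      + 1 / r * (s * ((y - v) \<bullet> y') - w / 2 * (norm (y - v))\<^sup>2)"
    using fu gv by simp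
  also have "\<dots> = - (\<sigma> * (A (x - u) \<bullet> y')) - \<sigma> * (A x' \<bullet> (y - v)) - 2 * z * (\<sigma> * (A x' \<bullet> y'))
      - (z * s * (r * (norm x')\<^sup>2 + (norm y')\<^sup>2 / r)
        + w / 2 * (r * (norm (x - u))\<^sup>2 + (norm (y - v))\<^sup>2 / r))"
    unfolding ph qh \<alpha> \<delta> \<beta>\<gamma>
    by (simp add: A.diff inner_diff_left inner_diff_right inner_commute dot_square_norm
        diff_divide_distrib add_divide_distrib algebra_simps)
  also have "\<dots> \<le> 2 * z * w * (norm (x - u) * norm y') + 2 * z * w * (norm x' * norm (y - v))
        + 2 * z * (2 * z * w * (norm x' * norm y'))
      - (z * s * (r * (norm x')\<^sup>2 + (norm y')\<^sup>2 / r)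
        + w / 2 * (r * (norm (x - u))\<^sup>2 + (norm (y - v))\<^sup>2 / r))"
  proof -
    have "2 * z * - (\<sigma> * (A x' \<bullet> y')) \<le> 2 * z * (2 * z * w * (norm x' * norm y'))"
      by (rule mult_left_mono[OF abs_le_D2[OF cross]]) (use z(2) in simp)
    then have "- (2 * z * (\<sigma> * (A x' \<bullet> y'))) \<le> 2 * z * (2 * z * w * (norm x' * norm y'))"
      by (simp only: mult_minus_right)
    then show ?thesis
      using abs_le_D2[OF cross[of "x - u" y']] abs_le_D2[OF cross[of x' "y - v"]] by linarith
  qed
  also have "\<dots> \<le> 0"
  proof -
    have "2 * z * w * (norm (x - u) * norm y') + 2 * z * w * (norm x' * norm (y - v))
        + 2 * z * (2 * z * w * (norm x' * norm y'))
      = 2 * z * w * (norm y' * norm (x - u) + norm x' * norm (y - v)) + 4 * z\<^sup>2 * w * (norm x' * norm y')"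
      by (simp add: power2_eq_square algebra_simps)
    then show ?thesis
      using young_cross_terms[OF r w less_imp_le[OF z(2)] s, of "norm y'" "norm (x - u)" "norm x'" "norm (y - v)"]
      by linarith
  qed
  finally show ?thesis .
qed

section \<open>The primal-dual flow and its energy\<close>

locale pd_flow =
  fixes f :: "'a::{real_inner, complete_space} \<Rightarrow> ereal"
    and g :: "'b::{real_inner, complete_space} \<Rightarrow> ereal"
    and A :: "'a \<Rightarrow> 'b"
    and \<alpha> \<beta> \<gamma> \<delta> Z W \<Xi> :: "real \<Rightarrow> real"
    and \<alpha>0 \<delta>0 Z0 :: real
    and x :: "real \<Rightarrow> 'a" and y :: "real \<Rightarrow> 'b"
  assumes f: "proper_fun f" and g: "proper_fun g" and A: "bounded_linear A"
    and \<beta>: "continuous_on {0..} \<beta>" and \<gamma>: "continuous_on {0..} \<gamma>"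
    and \<beta>_gt_\<gamma>: "\<And>t. t \<ge> 0 \<Longrightarrow> \<beta> t > \<gamma> t"
    and pos: "\<alpha>0 > 0" "\<delta>0 > 0"
    and Z_def: "\<And>t. Z t = (\<beta> t - \<gamma> t) / 2"
    and Z0_def: "Z0 = Z 0"
    and W_def: "\<And>t. W t = onorm A / 2 * (\<bar>\<beta> t + \<gamma> t\<bar> / (\<beta> t - \<gamma> t))"
    and \<Xi>_def: "\<And>t. \<Xi> t = Z0 / Z t * exp (integral {0..t} (\<lambda>s. 1 / Z s))"
    and \<alpha>_def: "\<And>t. \<alpha> t =
      1 / \<Xi> t * (\<alpha>0 - sqrt (\<alpha>0 / \<delta>0) * integral {0..t} (\<lambda>s. \<Xi> s * W s))"
    and \<delta>_def: "\<And>t. \<delta> t =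
      1 / \<Xi> t * (\<delta>0 - sqrt (\<delta>0 / \<alpha>0) * integral {0..t} (\<lambda>s. \<Xi> s * W s))"
    and param: "\<And>t. t \<ge> 0 \<Longrightarrow>
      4 * Z t * \<Xi> t * W t + integral {0..t} (\<lambda>s. \<Xi> s * W s) \<le> sqrt (\<alpha>0 * \<delta>0)"
    and traj: "pd_trajectory f g A \<alpha> \<beta> \<gamma> \<delta> x y"
begin

abbreviation "gc \<equiv> fenchel_conjugate g"

definition "J t = integral {0..t} (\<lambda>s. 1 / Z s)"
definition "I t = integral {0..t} (\<lambda>s. \<Xi> s * W s)"
text \<open>With \<open>c\<close> and \<open>\<rho>\<close> both damping coefficients become multiples of one
function, \<open>(c - I) / \<Xi>\<close>, by the factors \<open>\<rho>\<close> and \<open>1 / \<rho>\<close>.\<close>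

definition "c = sqrt (\<alpha>0 * \<delta>0)"
definition "\<rho> = sqrt (\<alpha>0 / \<delta>0)"
definition "fx t = real_of_ereal (f (x t))"
definition "gy t = real_of_ereal (gc (y t))"
text \<open>The gap and the energy are real valued: the finite values of \<open>f u\<close> and
\<open>g\<^sup>* v\<close> are passed as \<open>fu\<close> and \<open>gv\<close>.\<close>

definition "gap fu gv u v t = fx t - fu + v \<bullet> A (x t - u) + gy t - gv - (y t - v) \<bullet> A u"
definition "energy fu gv u v t = Z0 * exp (J t) * gap fu gv u v t
  + \<rho> / 2 * (c - I t) * (norm (x t - u))\<^sup>2 + 1 / (2 * \<rho>) * (c - I t) * (norm (y t - v))\<^sup>2"

lemma Z_pos: "t \<ge> 0 \<Longrightarrow> Z t > 0"
  using \<beta>_gt_\<gamma>[of t] by (simp add: Z_def)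

lemma Z0_pos: "Z0 > 0"
  by (simp add: Z0_def Z_pos)

lemma continuous_Z: "continuous_on {0..} Z"
  unfolding Z_def[abs_def] by (intro continuous_on_divide continuous_on_diff continuous_on_const \<beta> \<gamma>) auto

lemma continuous_inverse_Z: "continuous_on {0..} (\<lambda>s. 1 / Z s)"
  by (intro continuous_on_divide continuous_on_const continuous_Z) (auto dest: Z_pos)

lemma integral_has_derivative:
  fixes h :: "real \<Rightarrow> real"
  assumes h: "continuous_on {0..} h"
  shows "0 \<le> t \<Longrightarrow> t \<le> T \<Longrightarrow> ((\<lambda>t. integral {0..t} h) has_real_derivative h t) (at t within {0..T})"
    and "0 < t \<Longrightarrow> ((\<lambda>t. integral {0..t} h) has_real_derivative h t) (at t)"
proof -
  have *: "((\<lambda>t. integral {0..t} h) has_real_derivative h t) (at t within {0..T})"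
    if "0 \<le> t" "t \<le> T" for t T
    using that by (intro integral_has_real_derivative continuous_on_subset[OF h]) auto
  show "0 \<le> t \<Longrightarrow> t \<le> T \<Longrightarrow> ((\<lambda>t. integral {0..t} h) has_real_derivative h t) (at t within {0..T})"
    by (rule *)
  show "((\<lambda>t. integral {0..t} h) has_real_derivative h t) (at t)" if "0 < t"
    using *[of t "t + 1"] that at_within_interior[of t "{0..t + 1}"] by simp
qed

lemma J_derivative:
  "0 \<le> t \<Longrightarrow> t \<le> T \<Longrightarrow> (J has_real_derivative 1 / Z t) (at t within {0..T})"
  "0 < t \<Longrightarrow> (J has_real_derivative 1 / Z t) (at t)"
  unfolding J_def[abs_def] using integral_has_derivative[OF continuous_inverse_Z] by simp_all

lemma continuous_J_interval: "continuous_on {0..T} J"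
  by (rule DERIV_continuous_on[where D = "\<lambda>t. 1 / Z t"]) (auto intro!: J_derivative)

lemma continuous_J: "continuous_on {0..} J"
  unfolding continuous_on_eq_continuous_within
proof
  fix t :: real assume t: "t \<in> {0..}"
  have "continuous (at t within {0..t + 1}) J"
    using continuous_J_interval[of "t + 1"] t by (simp add: continuous_on_eq_continuous_within)
  moreover have "at t within {0..} = at t within {0..t + 1}"
    using t by (intro at_within_nhd[of _ "{..<t + 1}"]) auto
  ultimately show "continuous (at t within {0..}) J" by simp
qed

lemma \<Xi>_eq: "\<Xi> t = Z0 / Z t * exp (J t)"
  by (simp add: \<Xi>_def J_def)

lemma \<Xi>_pos: "t \<ge> 0 \<Longrightarrow> \<Xi> t > 0"
  using Z_pos[of t] Z0_pos by (simp add: \<Xi>_eq)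

lemma W_nonneg: "t \<ge> 0 \<Longrightarrow> W t \<ge> 0"
  using \<beta>_gt_\<gamma>[of t] onorm_pos_le[OF A] by (simp add: W_def)

lemma continuous_\<Xi>W: "continuous_on {0..} (\<lambda>s. \<Xi> s * W s)"
  unfolding \<Xi>_eq W_def
  by (intro continuous_on_mult continuous_on_divide continuous_on_const continuous_on_rabs
      continuous_on_add continuous_on_diff continuous_on_exp continuous_Z continuous_J \<beta> \<gamma>)
    (auto dest: Z_pos \<beta>_gt_\<gamma>)

lemma I_derivative:
  "0 \<le> t \<Longrightarrow> t \<le> T \<Longrightarrow> (I has_real_derivative \<Xi> t * W t) (at t within {0..T})"
  "0 < t \<Longrightarrow> (I has_real_derivative \<Xi> t * W t) (at t)"
  unfolding I_def[abs_def] using integral_has_derivative[OF continuous_\<Xi>W] by simp_all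

lemma I_bound: "t \<ge> 0 \<Longrightarrow> 4 * Z t * \<Xi> t * W t \<le> c - I t"
  using param[of t] by (simp add: c_def I_def)

lemma I_le: "t \<ge> 0 \<Longrightarrow> I t \<le> c"
proof -
  assume t: "t \<ge> 0"
  have "0 \<le> 4 * Z t * \<Xi> t * W t"
    using Z_pos[OF t] \<Xi>_pos[OF t] W_nonneg[OF t] by simp
  with I_bound[OF t] show ?thesis by linarith
qed

lemma c_pos: "c > 0" and \<rho>_pos: "\<rho> > 0"
  using pos by (simp_all add: c_def \<rho>_def)

lemma \<rho>c: "\<rho> * c = \<alpha>0" "c / \<rho> = \<delta>0"
  using pos unfolding c_def \<rho>_def real_sqrt_mult[symmetric] real_sqrt_divide[symmetric]
  by (simp_all add: real_sqrt_mult)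

lemma \<alpha>_eq: "\<alpha> t = \<rho> * ((c - I t) / \<Xi> t)"
proof -
  have "\<alpha>0 - \<rho> * I t = \<rho> * (c - I t)" by (simp add: right_diff_distrib \<rho>c)
  then show ?thesis by (simp add: \<alpha>_def \<rho>_def I_def)
qed

lemma \<delta>_eq: "\<delta> t = (c - I t) / \<Xi> t / \<rho>"
proof -
  have "sqrt (\<delta>0 / \<alpha>0) = 1 / \<rho>" by (simp add: \<rho>_def real_sqrt_divide)
  moreover have "\<delta>0 - 1 / \<rho> * I t = (c - I t) / \<rho>" by (simp add: diff_divide_distrib \<rho>c)
  ultimately show ?thesis by (simp add: \<delta>_def I_def)
qed

lemma gc_not_MInf: "gc v \<noteq> -\<infinity>"
proof -
  obtain z where "g z \<noteq> \<infinity>" "g z \<noteq> -\<infinity>" using g by (auto simp: proper_fun_def)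
  then show ?thesis using fenchel_young[of v z g] by (cases "g z") auto
qed

lemma traj_finite: "t \<ge> 0 \<Longrightarrow> f (x t) = ereal (fx t)" "t \<ge> 0 \<Longrightarrow> gc (y t) = ereal (gy t)"
  using traj by (auto simp: pd_trajectory_def fx_def gy_def ereal_real)

lemma energy_abs_continuous:
  assumes T: "T > 0"
  shows "abs_continuous_on {0..T} (energy fu gv u v)"
proof -
  have x: "abs_continuous_on {0..T} x" and y: "abs_continuous_on {0..T} y"
    and fx: "abs_continuous_on {0..T} fx" and gy: "abs_continuous_on {0..T} gy"
    using traj T unfolding pd_trajectory_def locally_abs_continuous_def fx_def[abs_def] gy_def[abs_def]
    by blast+
  have I: "abs_continuous_on {0..T} I"
    by (rule abs_continuous_on_derivative[OF I_derivative(1)])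
      (auto intro: continuous_on_subset[OF continuous_\<Xi>W])
  have expJ: "abs_continuous_on {0..T} (\<lambda>t. exp (J t))"
  proof (rule abs_continuous_on_derivative)
    show "((\<lambda>t. exp (J t)) has_real_derivative exp (J t) * (1 / Z t)) (at t within {0..T})"
      if "t \<in> {0..T}" for t
      using that by (intro DERIV_chain2[OF DERIV_exp J_derivative(1)]) auto
    show "continuous_on {0..T} (\<lambda>t. exp (J t) * (1 / Z t))"
      by (intro continuous_intros continuous_J_interval continuous_on_subset[OF continuous_inverse_Z]) auto
  qed
  show ?thesis
    unfolding energy_def[abs_def] gap_def[abs_def] power2_norm_eq_inner
    by (intro abs_continuous_on_add abs_continuous_on_diff abs_continuous_on_const x y fx gy I expJ
        abs_continuous_on_bounded_bilinear[OF bounded_bilinear_mult]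
        abs_continuous_on_bounded_bilinear[OF bounded_bilinear_inner]
        abs_continuous_on_bounded_linear[OF A])
qed

text \<open>The minorant replaces \<open>f (x s)\<close> by \<open>f (x t) + \<langle>p, x s - x t\<rangle>\<close> and \<open>g\<^sup>* (y s)\<close> likewise. It is
differentiable at \<open>t\<close> as soon as \<open>x\<close> and \<open>y\<close> are, and lies below the energy because the gap has a
positive weight.\<close>

lemma energy_tangent_minorant:
  assumes t: "t > 0" and u: "f u = ereal fu" and v: "gc v = ereal gv"
    and x': "(x has_vector_derivative x') (at t)" and y': "(y has_vector_derivative y') (at t)"
    and p: "p \<in> subdifferential f (x t)"
      "p = - (\<alpha> t *\<^sub>R x' + \<beta> t *\<^sub>R adjoint A y' + adjoint A (y t))"
    and q: "q \<in> subdifferential gc (y t)"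
      "q = - (\<gamma> t *\<^sub>R A x' + \<delta> t *\<^sub>R y' - A (x t))"
  shows "\<exists>R m. R t = energy fu gv u v t \<and> (\<forall>s\<ge>0. R s \<le> energy fu gv u v s)
    \<and> (R has_real_derivative m) (at t) \<and> m \<le> 0"
proof -
  define a where "a s = fx t + p \<bullet> (x s - x t) - fu + v \<bullet> A (x s - u)
      + (gy t + q \<bullet> (y s - y t)) - gv - (y s - v) \<bullet> A u" for s
  define a' where "a' = p \<bullet> x' + v \<bullet> A x' + q \<bullet> y' - y' \<bullet> A u"
  define R where "R s = Z0 * exp (J s) * a s
    + \<rho> / 2 * (c - I s) * ((x s - u) \<bullet> (x s - u))
    + 1 / (2 * \<rho>) * (c - I s) * ((y s - v) \<bullet> (y s - v))" for s
  define m where "m = Z0 * (exp (J t) * (1 / Z t) * a t + exp (J t) * a')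
    + \<rho> / 2 * (- (\<Xi> t * W t) * (norm (x t - u))\<^sup>2 + (c - I t) * (2 * ((x t - u) \<bullet> x')))
    + 1 / (2 * \<rho>) * (- (\<Xi> t * W t) * (norm (y t - v))\<^sup>2 + (c - I t) * (2 * ((y t - v) \<bullet> y')))"
  have sub: "fx t + p \<bullet> (z - x t) \<le> b" if "f z = ereal b" for z b
    using p(1) t that by (force simp: subdifferential_def traj_finite dest: spec[of _ z])
  have sub': "gy t + q \<bullet> (z - y t) \<le> b" if "gc z = ereal b" for z b
    using q(1) t that by (force simp: subdifferential_def traj_finite dest: spec[of _ z])
  have "R s \<le> energy fu gv u v s" if s: "s \<ge> 0" for s
  proof -
    have "a s \<le> gap fu gv u v s"
      using sub[OF traj_finite(1)[OF s]] sub'[OF traj_finite(2)[OF s]] by (simp add: a_def gap_def)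
    then show ?thesis
      using Z0_pos by (simp add: R_def energy_def power2_norm_eq_inner mult_left_mono)
  qed
  moreover have "R t = energy fu gv u v t"
    by (simp add: R_def energy_def a_def gap_def power2_norm_eq_inner)
  moreover have "(R has_real_derivative m) (at t)"
  proof -
    note lin = bounded_linear.has_vector_derivative
    have 1: "((\<lambda>s. p \<bullet> x s) has_real_derivative p \<bullet> x') (at t)"
      "((\<lambda>s. q \<bullet> y s) has_real_derivative q \<bullet> y') (at t)"
      "((\<lambda>s. v \<bullet> A (x s)) has_real_derivative v \<bullet> A x') (at t)"
      "((\<lambda>s. y s \<bullet> A u) has_real_derivative y' \<bullet> A u) (at t)"
      unfolding has_real_derivative_iff_has_vector_derivative
      by (intro lin[OF bounded_linear_inner_right] lin[OF bounded_linear_inner_left] lin[OF A] x' y')+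
    have a: "(a has_real_derivative a') (at t)"
      unfolding a_def[abs_def] a'_def linear_diff[OF bounded_linear.linear[OF A]]
        inner_diff_right inner_diff_left
      by (auto intro!: derivative_eq_intros 1)
    have sq: "((\<lambda>s. (h s - w) \<bullet> (h s - w)) has_real_derivative 2 * ((h t - w) \<bullet> h')) (at t)"
      if h: "(h has_vector_derivative h') (at t)" for h :: "real \<Rightarrow> 'c::real_inner" and h' w
    proof -
      have "((\<lambda>s. h s - w) has_vector_derivative h') (at t)"
        using h by (auto intro!: derivative_eq_intros)
      from bounded_bilinear.has_vector_derivative[OF bounded_bilinear_inner this this]
      show ?thesis
        by (simp add: has_real_derivative_iff_has_vector_derivative inner_commute)
    qed
    have expJ: "((\<lambda>s. exp (J s)) has_real_derivative exp (J t) * (1 / Z t)) (at t)"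
      by (intro DERIV_fun_exp J_derivative t)
    \<comment> \<open>Stated for abstract factors, so that the product rule is not disturbed by expanding inner products.\<close>
    have leibniz: "((\<lambda>s. Z0 * E s * b s + \<kappa> * (c - I s) * n s + \<kappa>' * (c - I s) * k s)
        has_real_derivative Z0 * (E' * b t + E t * b')
          + \<kappa> * (- (\<Xi> t * W t) * n t + (c - I t) * n') + \<kappa>' * (- (\<Xi> t * W t) * k t + (c - I t) * k')) (at t)"
      if "(E has_real_derivative E') (at t)" "(b has_real_derivative b') (at t)"
        "(n has_real_derivative n') (at t)" "(k has_real_derivative k') (at t)"
      for E b n k :: "real \<Rightarrow> real" and E' b' n' k' \<kappa> \<kappa>'
      using that I_derivative(2)[OF t] by (auto intro!: derivative_eq_intros simp: algebra_simps)
    show ?thesis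
      unfolding R_def[abs_def] m_def power2_norm_eq_inner
      by (rule leibniz[OF expJ a sq[OF x'] sq[OF y']])
  qed
  moreover have "m \<le> 0"
  proof -
    define s where "s = (c - I t) / \<Xi> t"
    have t0: "t \<ge> 0" using t by simp
    note [simp] = Z_pos[OF t0] \<Xi>_pos[OF t0]
    have [simp]: "Z t \<noteq> 0" "\<Xi> t \<noteq> 0" using Z_pos[OF t0] \<Xi>_pos[OF t0] by linarith+
    have Z0e: "Z0 * exp (J t) = \<Xi> t * Z t" by (simp add: \<Xi>_eq)
    have cI: "c - I t = \<Xi> t * s" by (simp add: s_def)
    have "(fx t - fu + v \<bullet> A (x t - u) + gy t - gv - (y t - v) \<bullet> A u)
      + Z t * (p \<bullet> x' + v \<bullet> A x' + q \<bullet> y' - y' \<bullet> A u)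
      + \<rho> * (s * ((x t - u) \<bullet> x') - W t / 2 * (norm (x t - u))\<^sup>2)
      + 1 / \<rho> * (s * ((y t - v) \<bullet> y') - W t / 2 * (norm (y t - v))\<^sup>2) \<le> 0" (is "?e \<le> 0")
    proof (rule energy_dissipation[OF A \<rho>_pos W_nonneg[OF t0] _ _ Z_def Z_pos[OF t0] _ _ p(2) q(2)
          sub[OF u] sub'[OF v]])
      show "\<alpha> t = \<rho> * s" "\<delta> t = s / \<rho>" by (simp_all add: \<alpha>_eq \<delta>_eq s_def)
      show "4 * Z t * W t = onorm A * \<bar>\<beta> t + \<gamma> t\<bar>"
        using \<beta>_gt_\<gamma>[OF t0] by (simp add: Z_def W_def)
      show "4 * Z t * W t \<le> s"
        using I_bound[OF t0] by (simp add: s_def pos_le_divide_eq algebra_simps)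
    qed
    moreover have "m = \<Xi> t * ?e"
    proof -
      have "Z0 * (exp (J t) * (1 / Z t) * a t + exp (J t) * a')
          = (Z0 * exp (J t)) / Z t * a t + (Z0 * exp (J t)) * a'"
        by (simp add: algebra_simps)
      also have "\<dots> = \<Xi> t * (a t + Z t * a')" unfolding Z0e by (simp add: algebra_simps)
      finally show ?thesis
        unfolding m_def cI by (simp add: a_def a'_def algebra_simps)
    qed
    ultimately show ?thesis
      using \<Xi>_pos[OF t0] by (metis less_imp_le mult_nonneg_nonpos)
  qed
  ultimately show ?thesis by blast
qed

lemma energy_nonincreasing:
  assumes u: "f u = ereal fu" and v: "gc v = ereal gv" and T: "T \<ge> 0"
  shows "energy fu gv u v T \<le> energy fu gv u v 0"
proof (cases "T = 0")
  case False
  then have T: "T > 0" using T by simp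
  define P where "P t \<longleftrightarrow> (\<exists>x' y'.
        (x has_vector_derivative x') (at t) \<and> (y has_vector_derivative y') (at t) \<and>
        0 \<in> (\<lambda>\<xi>. \<alpha> t *\<^sub>R x' + \<beta> t *\<^sub>R adjoint A y' + \<xi> + adjoint A (y t)) ` subdifferential f (x t) \<and>
        0 \<in> (\<lambda>\<eta>. \<gamma> t *\<^sub>R A x' + \<delta> t *\<^sub>R y' - A (x t) + \<eta>) ` subdifferential gc (y t))" for t
  have "AE t in lborel. t > 0 \<longrightarrow> P t" using traj unfolding pd_trajectory_def P_def by (elim conjE)
  then obtain N where N: "{t \<in> space lborel. \<not> (t > 0 \<longrightarrow> P t)} \<subseteq> N"
    "emeasure lborel N = 0" "N \<in> sets lborel"
    by (rule AE_E)
  show ?thesis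
  proof (rule abs_continuous_on_tangent_minorants_imp_le[OF T energy_abs_continuous[OF T]
          null_setsI[OF N(2,3)]])
    fix t assume t: "0 < t" "t \<le> T" "t \<notin> N"
    then have "P t" using N(1) by auto
    then obtain x' y' p q where d: "(x has_vector_derivative x') (at t)"
      "(y has_vector_derivative y') (at t)"
      "p \<in> subdifferential f (x t)" "0 = \<alpha> t *\<^sub>R x' + \<beta> t *\<^sub>R adjoint A y' + p + adjoint A (y t)"
      "q \<in> subdifferential gc (y t)" "0 = \<gamma> t *\<^sub>R A x' + \<delta> t *\<^sub>R y' - A (x t) + q"
      unfolding P_def by blast
    have "p = - (\<alpha> t *\<^sub>R x' + \<beta> t *\<^sub>R adjoint A y' + adjoint A (y t))"
      using d(4) by (simp add: eq_neg_iff_add_eq_0 algebra_simps)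
    moreover have "q = - (\<gamma> t *\<^sub>R A x' + \<delta> t *\<^sub>R y' - A (x t))"
      using d(6) by (simp add: eq_neg_iff_add_eq_0 algebra_simps)
    ultimately obtain R m where "R t = energy fu gv u v t" "\<forall>s\<ge>0. R s \<le> energy fu gv u v s"
      "(R has_real_derivative m) (at t)" "m \<le> 0"
      using energy_tangent_minorant[OF t(1) u v d(1,2) d(3) _ d(5)] by blast
    then show "\<exists>R m. R t = energy fu gv u v t \<and> (\<forall>s\<in>{0..T}. R s \<le> energy fu gv u v s) \<and>
        (R has_real_derivative m) (at t) \<and> m \<le> 0"
      by (intro exI[of _ R] exI[of _ m]) auto
  qed
qed simp

section \<open>Decay of the gap\<close>

definition "initial_energy fu gv u v = \<alpha>0 / (2 * Z0) * (norm (x 0 - u))\<^sup>2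
  + \<delta>0 / (2 * Z0) * (norm (y 0 - v))\<^sup>2 + gap fu gv u v 0"

lemma energy_at_0: "energy fu gv u v 0 = Z0 * initial_energy fu gv u v"
proof -
  have "J 0 = 0" "I 0 = 0" by (simp_all add: J_def I_def)
  then have "energy fu gv u v 0 = Z0 * gap fu gv u v 0 + (\<rho> * c) / 2 * (norm (x 0 - u))\<^sup>2
      + (c / \<rho>) / 2 * (norm (y 0 - v))\<^sup>2"
    by (simp add: energy_def)
  then show ?thesis
    unfolding \<rho>c using Z0_pos by (simp add: initial_energy_def distrib_left)
qed

lemma gap_bound:
  assumes u: "f u = ereal fu" and v: "gc v = ereal gv" and t: "t \<ge> 0"
  shows "gap fu gv u v t \<le> initial_energy fu gv u v * exp (- J t)"
proof -
  have "Z0 * exp (J t) * gap fu gv u v t \<le> energy fu gv u v t"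
    using I_le[OF t] \<rho>_pos by (simp add: energy_def)
  also have "\<dots> \<le> Z0 * initial_energy fu gv u v"
    using energy_nonincreasing[OF u v t] by (simp add: energy_at_0)
  finally have "exp (J t) * gap fu gv u v t \<le> initial_energy fu gv u v"
    using Z0_pos by (simp add: mult.assoc)
  then show ?thesis by (simp add: exp_minus field_simps)
qed

lemma duality_gap_eq:
  assumes "f u = ereal fu" "gc v = ereal gv" "t \<ge> 0"
  shows "duality_gap f g A x y u v t = ereal (gap fu gv u v t)"
  by (simp add: assms duality_gap_def lagrangian_def traj_finite gap_def
      linear_diff[OF bounded_linear.linear[OF A]] inner_diff_left inner_diff_right)

lemma duality_gap_infinite:
  assumes "f u = \<infinity> \<or> gc v = \<infinity>" "t \<ge> 0"
  shows "duality_gap f g A x y u v t = -\<infinity>"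
proof -
  have "f u \<noteq> -\<infinity>" using f by (simp add: proper_fun_def)
  then show ?thesis
    using assms gc_not_MInf[of v] unfolding duality_gap_def lagrangian_def traj_finite[OF assms(2)]
    by (cases "f u"; cases "gc v") auto
qed

text \<open>At a solution the two inclusions of the optimality system say exactly that the primal and the dual
part of the gap are nonnegative, so each part is bounded by the gap.\<close>

lemma solution_parts:
  assumes S: "(xb, yb) \<in> primal_dual_solutions f g A"
  obtains a b where "f xb = ereal a" "gc yb = ereal b"
    "\<And>t. t \<ge> 0 \<Longrightarrow> 0 \<le> fx t - a + adjoint A yb \<bullet> (x t - xb)"
    "\<And>t. t \<ge> 0 \<Longrightarrow> 0 \<le> gy t - b + (y t - yb) \<bullet> (- A xb)"
    "\<And>t. gap a b xb yb t
      = (fx t - a + adjoint A yb \<bullet> (x t - xb)) + (gy t - b + (y t - yb) \<bullet> (- A xb))"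
proof -
  have sub: "f xb + ereal ((- adjoint A yb) \<bullet> (z - xb)) \<le> f z"
    and sub': "gc yb + ereal (A xb \<bullet> (w - yb)) \<le> gc w" for z w
    using S by (simp_all add: primal_dual_solutions_def subdifferential_def)
  have "f xb \<noteq> \<infinity>" "gc yb \<noteq> \<infinity>"
    using sub[of "x 0"] sub'[of "y 0"] by (auto simp: traj_finite)
  moreover have "f xb \<noteq> -\<infinity>" using f by (simp add: proper_fun_def)
  ultimately obtain a b where ab: "f xb = ereal a" "gc yb = ereal b"
    using gc_not_MInf[of yb] by (cases "f xb"; cases "gc yb") auto
  show ?thesis
  proof (rule that[OF ab])
    fix t :: real assume t: "t \<ge> 0"
    show "0 \<le> fx t - a + adjoint A yb \<bullet> (x t - xb)"
      using sub[of "x t"] by (simp add: ab traj_finite[OF t])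
    show "0 \<le> gy t - b + (y t - yb) \<bullet> (- A xb)"
      using sub'[of "y t"] by (simp add: ab traj_finite[OF t] inner_commute)
  next
    fix t
    show "gap a b xb yb t
      = (fx t - a + adjoint A yb \<bullet> (x t - xb)) + (gy t - b + (y t - yb) \<bullet> (- A xb))"
      using inner_adjoint_bounded_linear[OF A, of "x t - xb" yb]
      by (simp add: gap_def inner_commute)
  qed
qed

lemma solution_finite:
  assumes "(xb, yb) \<in> primal_dual_solutions f g A"
  shows "\<exists>a b. f xb = ereal a \<and> gc yb = ereal b"
  by (rule solution_parts[OF assms]) blast

section \<open>Weak limit points\<close>

text \<open>\<open>f xb\<close> and \<open>g\<^sup>* yb\<close> are approximated by reals \<open>a, b\<close> from below, since it is not yet known that
they are finite; the lemma is also what shows that they are.\<close>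

lemma weak_limit_gap_le_0:
  assumes f': "convex_fun f" "lsc_fun f" and J: "filterlim J at_top at_top"
    and \<tau>: "filterlim \<tau> at_top sequentially"
    and X: "weakly_converges (\<lambda>k. x (\<tau> k)) xb" and Y: "weakly_converges (\<lambda>k. y (\<tau> k)) yb"
    and u: "f u = ereal fu" and v: "gc v = ereal gv"
    and a: "ereal a < f xb" and b: "ereal b < gc yb"
  shows "a - fu + v \<bullet> A (xb - u) + b - gv - (yb - v) \<bullet> A u \<le> 0"
proof -
  have "((\<lambda>k. initial_energy fu gv u v * exp (- J (\<tau> k))) \<longlongrightarrow> initial_energy fu gv u v * 0) sequentially"
    by (intro tendsto_mult tendsto_const filterlim_compose[OF exp_at_bot]
        filterlim_compose[OF filterlim_uminus_at_bot_at_top] filterlim_compose[OF J \<tau>])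
  moreover have "(\<lambda>k. a - fu + (x (\<tau> k) - u) \<bullet> adjoint A v + b - gv - (y (\<tau> k) - v) \<bullet> A u)
      \<longlonglongrightarrow> a - fu + (xb - u) \<bullet> adjoint A v + b - gv - (yb - v) \<bullet> A u"
    unfolding inner_diff_left
    by (intro tendsto_add tendsto_diff tendsto_const X[unfolded weakly_converges_def, rule_format]
        Y[unfolded weakly_converges_def, rule_format])
  moreover have "\<forall>\<^sub>F k in sequentially. a - fu + (x (\<tau> k) - u) \<bullet> adjoint A v + b - gv - (y (\<tau> k) - v) \<bullet> A u
      \<le> initial_energy fu gv u v * exp (- J (\<tau> k))"
    using convex_lsc_weakly_lsc[OF f' X a] fenchel_conjugate_weakly_lsc[OF Y b]
      \<tau>[unfolded filterlim_at_top, rule_format, of 0]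
  proof eventually_elim
    case (elim k)
    then have "a \<le> fx (\<tau> k)" "b \<le> gy (\<tau> k)" by (simp_all add: traj_finite)
    then show ?case
      using gap_bound[OF u v elim(3)]
      unfolding gap_def inner_adjoint_bounded_linear[OF A] inner_commute[of v "A (x (\<tau> k) - u)"]
      by linarith
  qed
  ultimately have "a - fu + (xb - u) \<bullet> adjoint A v + b - gv - (yb - v) \<bullet> A u \<le> initial_energy fu gv u v * 0"
    by (intro tendsto_le[OF sequentially_bot])
  then show ?thesis
    unfolding inner_adjoint_bounded_linear[OF A] inner_commute[of "A (xb - u)" v] by simp
qed

text \<open>Taking \<open>v = yb\<close> in the limiting gap inequality gives the inclusion for \<open>f\<close>, taking \<open>u = xb\<close> the one
for \<open>g\<^sup>*\<close>.\<close>

lemma weak_limit_point_is_solution: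
  assumes f': "convex_fun f" "lsc_fun f" and J: "filterlim J at_top at_top"
    and lim: "weak_subseq_limit_point (\<lambda>t. (x t, y t)) (xb, yb)"
  shows "(xb, yb) \<in> primal_dual_solutions f g A"
proof -
  obtain \<tau> where \<tau>: "filterlim \<tau> at_top sequentially"
    and XY: "weakly_converges (\<lambda>k. (x (\<tau> k), y (\<tau> k))) (xb, yb)"
    using lim by (auto simp: weak_subseq_limit_point_def)
  have X: "weakly_converges (\<lambda>k. x (\<tau> k)) xb"
    unfolding weakly_converges_def
  proof
    fix z show "(\<lambda>k. x (\<tau> k) \<bullet> z) \<longlonglongrightarrow> xb \<bullet> z"
      using XY[unfolded weakly_converges_def, rule_format, of "(z, 0)"] by (simp add: inner_prod_def)
  qed
  have Y: "weakly_converges (\<lambda>k. y (\<tau> k)) yb"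
    unfolding weakly_converges_def
  proof
    fix z show "(\<lambda>k. y (\<tau> k) \<bullet> z) \<longlonglongrightarrow> yb \<bullet> z"
      using XY[unfolded weakly_converges_def, rule_format, of "(0, z)"] by (simp add: inner_prod_def)
  qed
  note le0 = weak_limit_gap_le_0[OF f' J \<tau> X Y]
  have fxb: "f xb \<noteq> -\<infinity>" using f by (simp add: proper_fun_def)
  obtain a0 where a0: "ereal a0 < f xb" using fxb ereal_dense2[of "-\<infinity>" "f xb"] by auto
  obtain b0 where b0: "ereal b0 < gc yb" using gc_not_MInf[of yb] ereal_dense2[of "-\<infinity>" "gc yb"] by auto
  note le0' = le0[OF traj_finite(1)[of 0] traj_finite(2)[of 0]]
  \<comment> \<open>Otherwise \<open>a\<close> in \<open>weak_limit_gap_le_0\<close> could be chosen so large that the left side is 1.\<close>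
  have "f xb \<noteq> \<infinity>"
  proof
    assume inf: "f xb = \<infinity>"
    define K where "K = fx 0 - y 0 \<bullet> A (xb - x 0) - b0 + gy 0 + (yb - y 0) \<bullet> A (x 0) + 1"
    have "ereal K < f xb" by (simp add: inf)
    from le0'[OF _ _ this b0] show False by (simp add: K_def)
  qed
  moreover have "gc yb \<noteq> \<infinity>"
  proof
    assume inf: "gc yb = \<infinity>"
    define K where "K = fx 0 - y 0 \<bullet> A (xb - x 0) - a0 + gy 0 + (yb - y 0) \<bullet> A (x 0) + 1"
    have "ereal K < gc yb" by (simp add: inf)
    from le0'[OF _ _ a0 this] show False by (simp add: K_def)
  qed
  ultimately obtain a b where ab: "f xb = ereal a" "gc yb = ereal b"
    using gc_not_MInf[of yb] fxb by (cases "f xb"; cases "gc yb") auto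
  have saddle: "a - fu + v \<bullet> A (xb - u) + b - gv - (yb - v) \<bullet> A u \<le> 0"
    if "f u = ereal fu" "gc v = ereal gv" for u v fu gv
  proof (rule field_le_epsilon)
    fix e :: real assume "e > 0"
    then show "a - fu + v \<bullet> A (xb - u) + b - gv - (yb - v) \<bullet> A u \<le> 0 + e"
      using le0[OF that, of "a - e / 2" "b - e / 2"] by (simp add: ab)
  qed
  have A0: "A 0 = 0" by (rule linear_0[OF bounded_linear.linear[OF A]])
  have "f xb + ereal ((- adjoint A yb) \<bullet> (z - xb)) \<le> f z" for z
  proof (cases "f z")
    case (real r)
    have "adjoint A yb \<bullet> (z - xb) = A (z - xb) \<bullet> yb"
      using inner_adjoint_bounded_linear[OF A, of "z - xb" yb] by (simp add: inner_commute)
    then show ?thesis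
      using saddle[OF real ab(2)] real
      by (simp add: ab linear_diff[OF bounded_linear.linear[OF A]] inner_diff_left
          inner_diff_right inner_commute)
  qed (use f in \<open>auto simp: proper_fun_def\<close>)
  moreover have "gc yb + ereal (A xb \<bullet> (w - yb)) \<le> gc w" for w
  proof (cases "gc w")
    case (real r)
    then show ?thesis
      using saddle[OF ab(1) real] by (simp add: ab A0 inner_diff_left inner_diff_right inner_commute)
  qed (use gc_not_MInf in auto)
  ultimately show ?thesis by (simp add: primal_dual_solutions_def subdifferential_def)
qed

section \<open>Boundedness and convergence rates\<close>

text \<open>The gap at a solution is nonnegative and \<open>c - I\<close> is bounded below by \<open>\<kappa> > 0\<close>, so the energy controls
the distances to the solution.\<close>

lemma trajectory_bounded:
  assumes int: "(\<lambda>s. \<Xi> s * W s) integrable_on {0..}"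
    and less: "integral {0..} (\<lambda>s. \<Xi> s * W s) < sqrt (\<alpha>0 * \<delta>0)"
    and S: "(xb, yb) \<in> primal_dual_solutions f g A"
  shows "bounded ((\<lambda>t. (x t, y t)) ` {0..})"
proof -
  define \<kappa> where "\<kappa> = c - integral {0..} (\<lambda>s. \<Xi> s * W s)"
  have \<kappa>: "\<kappa> > 0" using less by (simp add: \<kappa>_def c_def)
  have \<kappa>_le: "\<kappa> \<le> c - I t" if "t \<ge> 0" for t
  proof -
    have "I t \<le> integral {0..} (\<lambda>s. \<Xi> s * W s)"
      unfolding I_def
    proof (rule integral_subset_le)
      show "(\<lambda>s. \<Xi> s * W s) integrable_on {0..t}"
        by (intro integrable_continuous_real continuous_on_subset[OF continuous_\<Xi>W]) auto
      show "\<forall>s\<in>{0..}. 0 \<le> \<Xi> s * W s"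
        using \<Xi>_pos W_nonneg by (auto intro: mult_nonneg_nonneg less_imp_le)
    qed (use int in auto)
    then show ?thesis by (simp add: \<kappa>_def)
  qed
  obtain a b where ab: "f xb = ereal a" "gc yb = ereal b"
    and nonneg: "\<And>t. t \<ge> 0 \<Longrightarrow> 0 \<le> fx t - a + adjoint A yb \<bullet> (x t - xb)"
      "\<And>t. t \<ge> 0 \<Longrightarrow> 0 \<le> gy t - b + (y t - yb) \<bullet> (- A xb)"
    and gap_eq: "\<And>t. gap a b xb yb t
      = (fx t - a + adjoint A yb \<bullet> (x t - xb)) + (gy t - b + (y t - yb) \<bullet> (- A xb))"
    using solution_parts[OF S] by blast
  define E where "E = energy a b xb yb 0"
  have E: "\<rho> / 2 * \<kappa> * (norm (x t - xb))\<^sup>2 + 1 / (2 * \<rho>) * \<kappa> * (norm (y t - yb))\<^sup>2 \<le> E"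
    if t: "t \<ge> 0" for t
  proof -
    have "0 \<le> gap a b xb yb t" using nonneg[OF t] by (simp add: gap_eq)
    then have "0 \<le> Z0 * exp (J t) * gap a b xb yb t" using Z0_pos by simp
    moreover have "\<rho> / 2 * \<kappa> * (norm (x t - xb))\<^sup>2 \<le> \<rho> / 2 * (c - I t) * (norm (x t - xb))\<^sup>2"
      using \<kappa>_le[OF t] \<rho>_pos by (intro mult_right_mono mult_left_mono) auto
    moreover have "1 / (2 * \<rho>) * \<kappa> * (norm (y t - yb))\<^sup>2 \<le> 1 / (2 * \<rho>) * (c - I t) * (norm (y t - yb))\<^sup>2"
      using \<kappa>_le[OF t] \<rho>_pos by (intro mult_right_mono mult_left_mono) auto
    ultimately show ?thesis
      using energy_nonincreasing[OF ab t] unfolding E_def energy_def[of a b xb yb t] by linarith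
  qed
  have "x t \<in> cball xb (sqrt (E / (\<rho> / 2 * \<kappa>)))" "y t \<in> cball yb (sqrt (E / (1 / (2 * \<rho>) * \<kappa>)))"
    if t: "t \<ge> 0" for t
  proof -
    have pos: "\<rho> / 2 * \<kappa> > 0" "1 / (2 * \<rho>) * \<kappa> > 0" using \<rho>_pos \<kappa> by simp_all
    then have "0 \<le> \<rho> / 2 * \<kappa> * (norm (x t - xb))\<^sup>2" "0 \<le> 1 / (2 * \<rho>) * \<kappa> * (norm (y t - yb))\<^sup>2"
      by (simp_all only: less_imp_le mult_nonneg_nonneg zero_le_power2)
    then have "(norm (x t - xb))\<^sup>2 * (\<rho> / 2 * \<kappa>) \<le> E" "(norm (y t - yb))\<^sup>2 * (1 / (2 * \<rho>) * \<kappa>) \<le> E"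
      using E[OF t] by (simp_all only: mult.commute[of "(norm _)\<^sup>2"])
    then have "(norm (x t - xb))\<^sup>2 \<le> E / (\<rho> / 2 * \<kappa>)" "(norm (y t - yb))\<^sup>2 \<le> E / (1 / (2 * \<rho>) * \<kappa>)"
      using pos by (simp_all only: pos_le_divide_eq)
    then show "x t \<in> cball xb (sqrt (E / (\<rho> / 2 * \<kappa>)))" "y t \<in> cball yb (sqrt (E / (1 / (2 * \<rho>) * \<kappa>)))"
      by (simp_all only: mem_cball dist_norm norm_minus_commute[of xb] norm_minus_commute[of yb]
          real_le_rsqrt)
  qed
  then have "(\<lambda>t. (x t, y t)) ` {0..}
      \<subseteq> cball xb (sqrt (E / (\<rho> / 2 * \<kappa>))) \<times> cball yb (sqrt (E / (1 / (2 * \<rho>) * \<kappa>)))"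
    by auto
  then show ?thesis by (rule bounded_subset[rotated]) (intro bounded_Times bounded_cball)
qed

lemma strongly_convex_rate:
  assumes sc: "strongly_convex_fun \<mu> f" and \<mu>: "\<mu> > 0"
    and S: "(xb, yb) \<in> primal_dual_solutions f g A"
    and ab: "f xb = ereal a" "gc yb = ereal b" and t: "t \<ge> 0"
  shows "(norm (x t - xb))\<^sup>2 \<le> 2 * initial_energy a b xb yb / \<mu> * exp (- J t)"
proof -
  obtain a' b' where ab': "f xb = ereal a'" "gc yb = ereal b'"
    and nonneg: "0 \<le> gy t - b' + (y t - yb) \<bullet> (- A xb)"
    and gap_eq: "gap a' b' xb yb t
      = (fx t - a' + adjoint A yb \<bullet> (x t - xb)) + (gy t - b' + (y t - yb) \<bullet> (- A xb))"
    using solution_parts[OF S] t by metis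
  have [simp]: "a' = a" "b' = b" using ab ab' by auto
  have "- adjoint A yb \<in> subdifferential f xb" using S by (simp add: primal_dual_solutions_def)
  from strongly_convex_growth[OF sc this, of "x t"]
  have "\<mu> / 2 * (norm (x t - xb))\<^sup>2 \<le> fx t - a + adjoint A yb \<bullet> (x t - xb)"
    by (simp add: ab traj_finite[OF t])
  also have "\<dots> \<le> gap a b xb yb t" using nonneg gap_eq by simp
  also have "\<dots> \<le> initial_energy a b xb yb * exp (- J t)" by (rule gap_bound[OF ab t])
  finally show ?thesis using \<mu> by (simp add: field_simps)
qed

lemma smooth_rate:
  assumes sm: "convex_fun g" "smooth_fun L g" and L: "L > 0"
    and S: "(xb, yb) \<in> primal_dual_solutions f g A"
    and ab: "f xb = ereal a" "gc yb = ereal b" and t: "t \<ge> 0"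
  shows "(norm (y t - yb))\<^sup>2 \<le> 2 * L * initial_energy a b xb yb * exp (- J t)"
proof -
  obtain a' b' where ab': "f xb = ereal a'" "gc yb = ereal b'"
    and nonneg: "0 \<le> fx t - a' + adjoint A yb \<bullet> (x t - xb)"
    and gap_eq: "gap a' b' xb yb t
      = (fx t - a' + adjoint A yb \<bullet> (x t - xb)) + (gy t - b' + (y t - yb) \<bullet> (- A xb))"
    using solution_parts[OF S] t by metis
  have [simp]: "a' = a" "b' = b" using ab ab' by auto
  have "A xb \<in> subdifferential gc yb" using S by (simp add: primal_dual_solutions_def)
  from smooth_conjugate_growth[OF sm L this, of "y t"]
  have "1 / (2 * L) * (norm (y t - yb))\<^sup>2 \<le> gy t - b + (y t - yb) \<bullet> (- A xb)"
    by (simp add: ab traj_finite[OF t] inner_commute)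
  also have "\<dots> \<le> gap a b xb yb t" using nonneg gap_eq by simp
  also have "\<dots> \<le> initial_energy a b xb yb * exp (- J t)" by (rule gap_bound[OF ab t])
  finally show ?thesis using L by (simp add: field_simps)
qed

lemma strongly_convex_converges:
  assumes sc: "strongly_convex_fun \<mu> f" and \<mu>: "\<mu> > 0" and J: "filterlim J at_top at_top"
    and S: "(xb, yb) \<in> primal_dual_solutions f g A"
  shows "(x \<longlongrightarrow> xb) at_top"
proof -
  obtain a b where ab: "f xb = ereal a" "gc yb = ereal b"
    using solution_finite[OF S] by blast
  have "((\<lambda>t. sqrt (2 * initial_energy a b xb yb / \<mu> * exp (- J t))) \<longlongrightarrow> sqrt (2 * initial_energy a b xb yb / \<mu> * 0)) at_top"
    by (intro tendsto_real_sqrt tendsto_mult tendsto_const filterlim_compose[OF exp_at_bot]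
        filterlim_compose[OF filterlim_uminus_at_bot_at_top] J)
  then have 0: "((\<lambda>t. sqrt (2 * initial_energy a b xb yb / \<mu> * exp (- J t))) \<longlongrightarrow> 0) at_top" by simp
  have "\<forall>\<^sub>F t in at_top. norm (x t - xb) \<le> sqrt (2 * initial_energy a b xb yb / \<mu> * exp (- J t))"
    using eventually_ge_at_top[of 0]
    by eventually_elim (rule real_le_rsqrt[OF strongly_convex_rate[OF sc \<mu> S ab]])
  from Lim_null_comparison[OF this 0] show ?thesis by (rule Lim_null[THEN iffD2])
qed

end

section \<open>Convergence of the primal-dual flow\<close>

theorem theorem4p7:
  fixes f :: "'a::{real_inner, complete_space} \<Rightarrow> ereal"
    and g :: "'b::{real_inner, complete_space} \<Rightarrow> ereal"
    and A :: "'a \<Rightarrow> 'b"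
    and \<alpha> \<beta> \<gamma> \<delta> Z W \<Xi> :: "real \<Rightarrow> real"
    and \<alpha>0 \<delta>0 Z0 :: real
    and x :: "real \<Rightarrow> 'a" and y :: "real \<Rightarrow> 'b"
    and x0 :: 'a and y0 :: 'b
    and S :: "('a \<times> 'b) set"
    and \<Delta> :: "'a \<Rightarrow> 'b \<Rightarrow> real \<Rightarrow> ereal"
    and D :: "'a \<Rightarrow> 'b \<Rightarrow> ereal"
  assumes f: "proper_fun f" "convex_fun f" "lsc_fun f"
    and g: "proper_fun g" "convex_fun g" "lsc_fun g"
    and A: "bounded_linear A"
    and \<beta>: "\<beta> differentiable_on {0..}"
    and \<gamma>: "\<gamma> differentiable_on {0..}"
    and \<beta>_gt_\<gamma>: "\<And>t. t \<ge> 0 \<Longrightarrow> \<beta> t > \<gamma> t"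
    and pos: "\<alpha>0 > 0" "\<delta>0 > 0"
    and Z_def: "\<And>t. Z t = (\<beta> t - \<gamma> t) / 2"
    and Z0_def: "Z0 = Z 0"
    and W_def: "\<And>t. W t = onorm A / 2 * (\<bar>\<beta> t + \<gamma> t\<bar> / (\<beta> t - \<gamma> t))"
    and \<Xi>_def: "\<And>t. \<Xi> t = Z0 / Z t * exp (integral {0..t} (\<lambda>s. 1 / Z s))"
    and \<alpha>_def: "\<And>t. \<alpha> t =
      1 / \<Xi> t * (\<alpha>0 - sqrt (\<alpha>0 / \<delta>0) * integral {0..t} (\<lambda>s. \<Xi> s * W s))"
    and \<delta>_def: "\<And>t. \<delta> t =
      1 / \<Xi> t * (\<delta>0 - sqrt (\<delta>0 / \<alpha>0) * integral {0..t} (\<lambda>s. \<Xi> s * W s))"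
    and param: "\<And>t. t \<ge> 0 \<Longrightarrow>
      4 * Z t * \<Xi> t * W t + integral {0..t} (\<lambda>s. \<Xi> s * W s) \<le> sqrt (\<alpha>0 * \<delta>0)"
    and traj: "pd_trajectory f g A \<alpha> \<beta> \<gamma> \<delta> x y"
    and init: "x 0 = x0" "y 0 = y0"
    and S_def: "S = primal_dual_solutions f g A"
    and \<Delta>_def: "\<And>u v t. \<Delta> u v t = duality_gap f g A x y u v t"
    and D_def: "\<And>u v. D u v =
      ereal (\<alpha>0 / (2 * Z0) * (norm (x0 - u))\<^sup>2 + \<delta>0 / (2 * Z0) * (norm (y0 - v))\<^sup>2) + \<Delta> u v 0"
  shows
    "(\<forall>u v. \<forall>t\<ge>0. \<Delta> u v t \<le> D u v * ereal (exp (- integral {0..t} (\<lambda>s. 1 / Z s))))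
   \<and> (\<forall>(xb, yb)\<in>S. \<forall>t\<ge>0.
        f (x t) - f xb + ereal (adjoint A yb \<bullet> (x t - xb))
          \<le> D xb yb * ereal (exp (- integral {0..t} (\<lambda>s. 1 / Z s)))
      \<and> fenchel_conjugate g (y t) - fenchel_conjugate g yb + ereal ((y t - yb) \<bullet> (- A xb))
          \<le> D xb yb * ereal (exp (- integral {0..t} (\<lambda>s. 1 / Z s))))
   \<and> (filterlim (\<lambda>t. integral {0..t} (\<lambda>s. 1 / Z s)) at_top at_top \<longrightarrow>
        (\<forall>p. weak_subseq_limit_point (\<lambda>t. (x t, y t)) p \<longrightarrow> p \<in> S))
   \<and> ((\<lambda>s. \<Xi> s * W s) integrable_on {0..} \<and>
        integral {0..} (\<lambda>s. \<Xi> s * W s) < sqrt (\<alpha>0 * \<delta>0) \<and> S \<noteq> {} \<longrightarrow>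
        bounded ((\<lambda>t. (x t, y t)) ` {0..}))
   \<and> (\<forall>\<mu>>0. filterlim (\<lambda>t. integral {0..t} (\<lambda>s. 1 / Z s)) at_top at_top \<and>
        strongly_convex_fun \<mu> f \<longrightarrow>
        (\<forall>(xb, yb)\<in>S. fst ` S = {xb} \<and> (x \<longlongrightarrow> xb) at_top \<and>
          (\<forall>t\<ge>0. ereal ((norm (x t - xb))\<^sup>2)
             \<le> 2 * D xb yb / ereal \<mu> * ereal (exp (- integral {0..t} (\<lambda>s. 1 / Z s))))))
   \<and> (\<forall>L>0. smooth_fun L g \<longrightarrow>
        (\<forall>(xb, yb)\<in>S. \<forall>t\<ge>0. ereal ((norm (y t - yb))\<^sup>2)
           \<le> 2 * ereal L * D xb yb * ereal (exp (- integral {0..t} (\<lambda>s. 1 / Z s)))))"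
proof -
  interpret F: pd_flow f g A \<alpha> \<beta> \<gamma> \<delta> Z W \<Xi> \<alpha>0 \<delta>0 Z0 x y
    using differentiable_imp_continuous_on[OF \<beta>] differentiable_imp_continuous_on[OF \<gamma>]
    by (intro pd_flow.intro f(1) g(1) A \<beta>_gt_\<gamma> pos Z_def Z0_def W_def \<Xi>_def \<alpha>_def \<delta>_def param traj)
  have D_eq: "D u v = ereal (F.initial_energy fu gv u v)" if "f u = ereal fu" "F.gc v = ereal gv" for u v fu gv
    using F.duality_gap_eq[OF that, of 0] by (simp add: D_def \<Delta>_def F.initial_energy_def init)
  have gap: "\<Delta> u v t \<le> D u v * ereal (exp (- F.J t))" if t: "t \<ge> 0" for u v t
  proof (cases "f u = \<infinity> \<or> F.gc v = \<infinity>")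
    case True
    then show ?thesis using F.duality_gap_infinite[OF True t] by (simp add: \<Delta>_def)
  next
    case False
    moreover have "f u \<noteq> -\<infinity>" using f(1) by (simp add: proper_fun_def)
    ultimately obtain fu gv where uv: "f u = ereal fu" "F.gc v = ereal gv"
      using F.gc_not_MInf[of v] by (cases "f u"; cases "F.gc v") auto
    then show ?thesis
      using F.gap_bound[OF uv t] by (simp add: \<Delta>_def F.duality_gap_eq[OF uv t] D_eq[OF uv])
  qed
  have parts: "f (x t) - f xb + ereal (adjoint A yb \<bullet> (x t - xb)) \<le> D xb yb * ereal (exp (- F.J t))
      \<and> F.gc (y t) - F.gc yb + ereal ((y t - yb) \<bullet> (- A xb)) \<le> D xb yb * ereal (exp (- F.J t))"
    if S: "(xb, yb) \<in> S" and t: "t \<ge> 0" for xb yb t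
  proof -
    obtain a b where ab: "f xb = ereal a" "F.gc yb = ereal b"
      and nonneg: "0 \<le> F.fx t - a + adjoint A yb \<bullet> (x t - xb)"
        "0 \<le> F.gy t - b + (y t - yb) \<bullet> (- A xb)"
      and gap_eq: "F.gap a b xb yb t
        = (F.fx t - a + adjoint A yb \<bullet> (x t - xb)) + (F.gy t - b + (y t - yb) \<bullet> (- A xb))"
      using F.solution_parts[OF S[unfolded S_def]] t by metis
    have "F.fx t - a + adjoint A yb \<bullet> (x t - xb) \<le> F.initial_energy a b xb yb * exp (- F.J t)"
      "F.gy t - b + (y t - yb) \<bullet> (- A xb) \<le> F.initial_energy a b xb yb * exp (- F.J t)"
      using F.gap_bound[OF ab t] gap_eq nonneg by linarith+
    then show ?thesis by (simp add: ab F.traj_finite[OF t] D_eq[OF ab])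
  qed
  have finite: "\<exists>a b. f xb = ereal a \<and> F.gc yb = ereal b" if "(xb, yb) \<in> S" for xb yb
    using F.solution_finite that by (simp add: S_def)
  have two: "(2::ereal) = ereal 2" by simp
  show ?thesis
    unfolding F.J_def[symmetric]
  proof (intro conjI allI ballI impI)
    show "\<Delta> u v t \<le> D u v * ereal (exp (- F.J t))" if "0 \<le> t" for u v t
      by (rule gap[OF that])
    show "case p of (xb, yb) \<Rightarrow> \<forall>t\<ge>0.
        f (x t) - f xb + ereal (adjoint A yb \<bullet> (x t - xb)) \<le> D xb yb * ereal (exp (- F.J t))
      \<and> F.gc (y t) - F.gc yb + ereal ((y t - yb) \<bullet> (- A xb)) \<le> D xb yb * ereal (exp (- F.J t))"
      if "p \<in> S" for p
      using parts that by (cases p) blast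
    show "p \<in> S" if "filterlim F.J at_top at_top" "weak_subseq_limit_point (\<lambda>t. (x t, y t)) p" for p
      using F.weak_limit_point_is_solution[OF f(2,3) that(1), of "fst p" "snd p"] that(2)
      by (simp add: S_def)
    show "bounded ((\<lambda>t. (x t, y t)) ` {0..})"
      if "(\<lambda>s. \<Xi> s * W s) integrable_on {0..} \<and>
        integral {0..} (\<lambda>s. \<Xi> s * W s) < sqrt (\<alpha>0 * \<delta>0) \<and> S \<noteq> {}"
      using F.trajectory_bounded that by (auto simp: S_def)
    show "case p of (xb, yb) \<Rightarrow> fst ` S = {xb} \<and> (x \<longlongrightarrow> xb) at_top \<and>
        (\<forall>t\<ge>0. ereal ((norm (x t - xb))\<^sup>2) \<le> 2 * D xb yb / ereal \<mu> * ereal (exp (- F.J t)))"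
      if \<mu>: "\<mu> > 0" and sc: "filterlim F.J at_top at_top \<and> strongly_convex_fun \<mu> f" and p: "p \<in> S"
      for \<mu> p
    proof -
      obtain xb yb where p_eq: "p = (xb, yb)" by (cases p)
      have conv: "(x \<longlongrightarrow> x1) at_top" if "(x1, y1) \<in> S" for x1 y1
        using F.strongly_convex_converges[of \<mu> x1 y1] sc \<mu> that by (simp add: S_def)
      have "fst q = xb" if "q \<in> S" for q
        by (rule tendsto_unique[OF _ conv[of "fst q" "snd q"] conv[OF p[unfolded p_eq]]])
          (simp_all add: that)
      then have fst_S: "fst ` S = {xb}" using imageI[OF p, of fst] unfolding p_eq fst_conv by blast
      obtain a b where ab: "f xb = ereal a" "F.gc yb = ereal b"
        using finite p p_eq by blast
      have "ereal ((norm (x t - xb))\<^sup>2) \<le> 2 * D xb yb / ereal \<mu> * ereal (exp (- F.J t))" if "t \<ge> 0" for t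
        using F.strongly_convex_rate[OF conjunct2[OF sc] \<mu> p[unfolded p_eq S_def] ab that]
          \<mu> by (simp add: D_eq[OF ab] two)
      then show ?thesis unfolding p_eq prod.case using fst_S conv[OF p[unfolded p_eq]] by blast
    qed
    show "case p of (xb, yb) \<Rightarrow> \<forall>t\<ge>0. ereal ((norm (y t - yb))\<^sup>2)
           \<le> 2 * ereal L * D xb yb * ereal (exp (- F.J t))"
      if L: "L > 0" and sm: "smooth_fun L g" and p: "p \<in> S" for L p
    proof -
      obtain xb yb where p_eq: "p = (xb, yb)" by (cases p)
      obtain a b where ab: "f xb = ereal a" "F.gc yb = ereal b"
        using finite p p_eq by blast
      have "ereal ((norm (y t - yb))\<^sup>2) \<le> 2 * ereal L * D xb yb * ereal (exp (- F.J t))" if "t \<ge> 0" for t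
        using F.smooth_rate[OF g(2) sm L p[unfolded p_eq S_def] ab that]
        by (simp add: D_eq[OF ab] two)
      then show ?thesis unfolding p_eq prod.case by blast
    qed
  qed
qed

end
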